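(* Let $\varphi=(\varphi_1,\ldots,\varphi_n)$ be a free holomorphic self-map of the noncommutative ball $[B(\mathcal H)^n]_1$. If $C_\varphi$ is a compact composition operator on $H^2_{\bf ball}$, then the scalar representation of $\varphi$ is a holomorphic self-map of $\mathbb B_n$ which has exactly one fixed point in the open ball $\mathbb B_n$.
   Context: $n\ge1$; $\mathcal H$ is a separable infinite dimensional complex Hilbert space. $\mathbb F_n^+$ is the free semigroup with generators $g_1,\ldots,g_n$ and identity $g_0$; $|g_0|=0$, $|\alpha|=k$ if $\alpha=g_{i_1}\cdots g_{i_k}$; $X_\alpha:=X_{i_1}\cdots X_{i_k}$, $X_{g_0}:=I$. $[B(\mathcal H)^n]_1:=\{(X_1,\ldots,X_n)\in B(\mathcal H)^n:\ \|X_1X_1^*+\cdots+X_nX_n^*\|^{1/2}<1\}$. A free holomorphic function $f:[B(\mathcal H)^n]_1\to B(\mathcal H)$ is a map $f(X)=\sum_{k=0}^\infty\sum_{|\alpha|=k}a_\alpha X_\alpha$ (series over $k$ converging in operator norm) with $a_\alpha\in\mathbb C$ and $\limsup_{k\to\infty}(\sum_{|\alpha|=k}|a_\alpha|^2)^{1/2k}\le1$. A free holomorphic self-map $\varphi=(\varphi_1,\ldots,\varphi_n)$ of $[B(\mathcal H)^n]_1$ has each $\varphi_i$ free holomorphic and maps $[B(\mathcal H)^n]_1$ into itself. With $\varphi_\alpha:=\varphi_{i_1}\cdots\varphi_{i_k}$, the composition is $(f\circ\varphi)(X)=\sum_{k=0}^\infty\sum_{|\alpha|=k}a_\alpha\varphi_\alpha(X)$.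 $H^2_{\bf ball}$ is the Hilbert space of free holomorphic functions $f=\sum_\alpha a_\alpha X_\alpha$ on $[B(\mathcal H)^n]_1$ with $\|f\|_2^2:=\sum_\alpha|a_\alpha|^2<\infty$; $C_\varphi f:=f\circ\varphi$ is a bounded operator on $H^2_{\bf ball}$. $\mathbb B_n$ is the open Euclidean unit ball of $\mathbb C^n$; identifying $\lambda\in\mathbb B_n$ with $(\lambda_1I,\ldots,\lambda_nI)$, the scalar representation of $\varphi$ is the map $\mathbb B_n\ni\lambda\mapsto\varphi(\lambda)\in\mathbb B_n$. *)

theory Defs
  imports "HOL-Analysis.Analysis"
begin

section \<open>Complex Hilbert spaces and their bounded operators\<close>

text \<open>The complex inner product is linear in its first argument; its real part is the
  inner product of the underlying real Hilbert space, so that norm, completeness and bounded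
  (real-linear) maps are those of the library.\<close>

class complex_hilbert = banach + real_inner +
  fixes scaleC :: "complex \<Rightarrow> 'a \<Rightarrow> 'a"  (infixr \<open>*\<^sub>C\<close> 75)
    and cinner :: "'a \<Rightarrow> 'a \<Rightarrow> complex"
  assumes scaleC_add_right: "c *\<^sub>C (x + y) = c *\<^sub>C x + c *\<^sub>C y"
    and scaleC_add_left: "(c + d) *\<^sub>C x = c *\<^sub>C x + d *\<^sub>C x"
    and scaleC_scaleC: "c *\<^sub>C d *\<^sub>C x = (c * d) *\<^sub>C x"
    and scaleC_of_real: "complex_of_real r *\<^sub>C x = r *\<^sub>R x"
    and cinner_commute: "cinner x y = cnj (cinner y x)"
    and cinner_add_left: "cinner (x + y) z = cinner x z + cinner y z"
    and cinner_scaleC_left: "cinner (c *\<^sub>C x) y = c * cinner x y"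
    and Re_cinner: "Re (cinner x y) = inner x y"

lemma vector_space_scaleC: "vector_space ((*\<^sub>C) :: complex \<Rightarrow> 'a::complex_hilbert \<Rightarrow> 'a)"
proof
  show "1 *\<^sub>C x = x" for x :: 'a
    using scaleC_of_real[of 1 x] by simp
qed (auto simp: scaleC_add_right scaleC_add_left scaleC_scaleC)

lemma norm_scaleC: "norm (c *\<^sub>C x) = cmod c * norm (x :: 'a::complex_hilbert)"
proof -
  have im: "Im (cinner x x) = 0"
    using arg_cong[OF cinner_commute[of x x], of Im] by simp
  have "cinner (c *\<^sub>C x) (c *\<^sub>C x) = c * cnj c * cinner x x"
    by (subst cinner_scaleC_left, subst cinner_commute, subst cinner_scaleC_left)
      (simp add: cinner_commute[of x x, symmetric])
  then have "Re (cinner (c *\<^sub>C x) (c *\<^sub>C x)) = (cmod c)\<^sup>2 * Re (cinner x x)"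
    by (simp add: im flip: complex_norm_square)
  then have "(norm (c *\<^sub>C x))\<^sup>2 = (cmod c * norm x)\<^sup>2"
    by (simp add: Re_cinner power2_norm_eq_inner power_mult_distrib)
  then show ?thesis
    by simp
qed

definition bounded_ops :: "('h::complex_hilbert \<Rightarrow>\<^sub>L 'h) set" where
  "bounded_ops = {T. \<forall>c x. blinfun_apply T (c *\<^sub>C x) = c *\<^sub>C blinfun_apply T x}"

definition op_adjoint :: "('h::complex_hilbert \<Rightarrow>\<^sub>L 'h) \<Rightarrow> 'h \<Rightarrow>\<^sub>L 'h" where
  "op_adjoint T =
     (THE S. \<forall>x y. cinner (blinfun_apply T x) y = cinner x (blinfun_apply S y))"

text \<open>The operator \<open>c I\<close>; the library has no complex scalar multiplication of real-linear
  operators, so \<open>c T\<close> is written \<open>scalar_op c o\<^sub>L T\<close>.\<close>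

definition scalar_op :: "complex \<Rightarrow> 'h::complex_hilbert \<Rightarrow>\<^sub>L 'h" where
  "scalar_op c = Blinfun (\<lambda>x. c *\<^sub>C x)"

lemma scalar_op_apply [simp]: "blinfun_apply (scalar_op c) x = c *\<^sub>C x"
proof -
  interpret vector_space "(*\<^sub>C) :: complex \<Rightarrow> 'a \<Rightarrow> 'a"
    by (rule vector_space_scaleC)
  have "bounded_linear (\<lambda>x::'a. c *\<^sub>C x)"
    by (rule bounded_linear_intro[of _ "cmod c"])
      (simp_all add: scaleC_add_right norm_scaleC mult.commute scale_left_commute
        scaleC_scaleC flip: scaleC_of_real)
  then show ?thesis
    by (simp add: scalar_op_def bounded_linear_Blinfun_apply)
qed

lemma scalar_op_add: "scalar_op (c + d) = scalar_op c + scalar_op d"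
  by (rule blinfun_eqI) (simp add: blinfun.add_left scaleC_add_left)

lemma scalar_op_scaleR: "scalar_op (r *\<^sub>R c) = r *\<^sub>R scalar_op c"
  by (rule blinfun_eqI)
    (simp add: blinfun.scaleR_left scaleR_conv_of_real scaleC_of_real flip: scaleC_scaleC)

lemma scalar_op_0: "scalar_op 0 = 0"
  using scalar_op_scaleR[of 0 0] by simp

lemma scalar_op_1: "scalar_op 1 = id_blinfun"
  by (rule blinfun_eqI) (use scaleC_of_real[of 1] in simp)

lemma scalar_op_mult: "scalar_op c o\<^sub>L scalar_op d = scalar_op (c * d)"
  by (rule blinfun_eqI) (simp add: scaleC_scaleC)

lemma scalar_op_sum: "(\<Sum>i\<in>A. scalar_op (g i)) = scalar_op (\<Sum>i\<in>A. g i)"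
  by (induction A rule: infinite_finite_induct) (simp_all add: scalar_op_add scalar_op_0)

lemma norm_scalar_op_le: "norm (scalar_op c) \<le> cmod c"
  by (rule norm_blinfun_bound) (simp_all add: norm_scaleC)

lemma norm_scalar_op:
  assumes "(x :: 'h::complex_hilbert) \<noteq> 0"
  shows "norm (scalar_op c :: 'h \<Rightarrow>\<^sub>L 'h) = cmod c"
proof (rule antisym[OF norm_scalar_op_le])
  have "cmod c * norm x \<le> norm (scalar_op c :: 'h \<Rightarrow>\<^sub>L 'h) * norm x"
    using norm_blinfun[of "scalar_op c" x] by (simp add: norm_scaleC)
  then show "cmod c \<le> norm (scalar_op c :: 'h \<Rightarrow>\<^sub>L 'h)"
    using assms by simp
qed

lemma cinner_scaleC_right: "cinner x (c *\<^sub>C y) = cnj c * cinner x y"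
  by (metis cinner_commute cinner_scaleC_left complex_cnj_mult)

lemma op_adjoint_scalar_op: "op_adjoint (scalar_op c) = scalar_op (cnj c)"
  unfolding op_adjoint_def
proof (rule the_equality)
  fix S :: "'a \<Rightarrow>\<^sub>L 'a"
  assume "\<forall>x y. cinner (blinfun_apply (scalar_op c) x) y = cinner x (blinfun_apply S y)"
  then have "cinner x (blinfun_apply S y) = cinner x (cnj c *\<^sub>C y)" for x y
    by (simp add: cinner_scaleC_left cinner_scaleC_right)
  then have "inner x (blinfun_apply S y) = inner x (cnj c *\<^sub>C y)" for x y
    by (simp flip: Re_cinner)
  then show "S = scalar_op (cnj c)"
    by (intro blinfun_eqI) (metis scalar_op_apply vector_eq_ldot)
qed (simp add: cinner_scaleC_left cinner_scaleC_right)

lemma closed_range_scalar_op: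
  "closed (range (scalar_op :: complex \<Rightarrow> 'h::complex_hilbert \<Rightarrow>\<^sub>L 'h))"
proof (cases "\<exists>x :: 'h. x \<noteq> 0")
  case True
  then obtain x :: 'h where x: "x \<noteq> 0"
    by blast
  have "bounded_linear (scalar_op :: complex \<Rightarrow> 'h \<Rightarrow>\<^sub>L 'h)"
    by (rule bounded_linear_intro[of _ 1])
      (simp_all add: scalar_op_add scalar_op_scaleR norm_scalar_op_le)
  then have "complete (range (scalar_op :: complex \<Rightarrow> 'h \<Rightarrow>\<^sub>L 'h))"
    by (intro complete_isometric_image[of 1])
      (simp_all add: norm_scalar_op[OF x] complete_UNIV)
  then show ?thesis
    by (rule complete_imp_closed)
next
  case False
  then have "T = 0" for T :: "'h \<Rightarrow>\<^sub>L 'h"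
    by (intro blinfun_eqI) auto
  then have "range (scalar_op :: complex \<Rightarrow> 'h \<Rightarrow>\<^sub>L 'h) = {0}"
    by auto
  then show ?thesis
    by simp
qed

lemma norm_power2_vec: "complex_of_real ((norm (z :: complex ^ 'n))\<^sup>2) = (\<Sum>i\<in>UNIV. z $ i * cnj (z $ i))"
  by (simp add: norm_vec_def L2_set_def sum_nonneg complex_norm_square[symmetric] del: of_real_power)

section \<open>Free holomorphic functions on the noncommutative ball\<close>

text \<open>Elements of the free semigroup on the (finite, nonempty) index type \<open>'n\<close> are words,
  i.e. lists over \<open>'n\<close>; the identity is the empty word.\<close>

definition nc_ball :: "(('h::complex_hilbert \<Rightarrow>\<^sub>L 'h) ^ 'n) set" where
  "nc_ball = {X. (\<forall>i. X $ i \<in> bounded_ops) \<and>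
     sqrt (norm (\<Sum>i\<in>UNIV. X $ i o\<^sub>L op_adjoint (X $ i))) < 1}"

definition word_op :: "('h::complex_hilbert \<Rightarrow>\<^sub>L 'h) ^ 'n \<Rightarrow> 'n list \<Rightarrow> 'h \<Rightarrow>\<^sub>L 'h" where
  "word_op X \<alpha> = foldr (\<lambda>i T. X $ i o\<^sub>L T) \<alpha> id_blinfun"

definition has_free_expansion ::
    "(('h::complex_hilbert \<Rightarrow>\<^sub>L 'h) ^ 'n \<Rightarrow> 'h \<Rightarrow>\<^sub>L 'h) \<Rightarrow> ('n list \<Rightarrow> complex) \<Rightarrow> bool" where
  "has_free_expansion f a \<longleftrightarrow>
     limsup (\<lambda>k. ereal (root (2 * k) (\<Sum>\<alpha> | length \<alpha> = k. (cmod (a \<alpha>))\<^sup>2))) \<le> 1 \<and>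
     (\<forall>X\<in>nc_ball. (\<lambda>k. \<Sum>\<alpha> | length \<alpha> = k. scalar_op (a \<alpha>) o\<^sub>L word_op X \<alpha>) sums f X)"

definition free_holomorphic ::
    "(('h::complex_hilbert \<Rightarrow>\<^sub>L 'h) ^ 'n \<Rightarrow> 'h \<Rightarrow>\<^sub>L 'h) \<Rightarrow> bool" where
  "free_holomorphic f \<longleftrightarrow> (\<exists>a. has_free_expansion f a)"

definition free_holomorphic_self_map ::
    "(('h::complex_hilbert \<Rightarrow>\<^sub>L 'h) ^ 'n \<Rightarrow> ('h \<Rightarrow>\<^sub>L 'h) ^ 'n) \<Rightarrow> bool" where
  "free_holomorphic_self_map \<phi> \<longleftrightarrow>
     (\<forall>i. free_holomorphic (\<lambda>X. \<phi> X $ i)) \<and> \<phi> ` nc_ball \<subseteq> nc_ball"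

section \<open>The Hardy space and composition operators\<close>

text \<open>The coefficients are unique when the Hilbert space is infinite dimensional.\<close>

definition free_coeff ::
    "(('h::complex_hilbert \<Rightarrow>\<^sub>L 'h) ^ 'n \<Rightarrow> 'h \<Rightarrow>\<^sub>L 'h) \<Rightarrow> 'n list \<Rightarrow> complex" where
  "free_coeff f = (THE a. has_free_expansion f a)"

text \<open>Members of the Hardy space are functions on the noncommutative ball, so they are
  normalised to be \<^const>\<open>undefined\<close> outside of it.\<close>

definition H2_ball :: "(('h::complex_hilbert \<Rightarrow>\<^sub>L 'h) ^ 'n \<Rightarrow> 'h \<Rightarrow>\<^sub>L 'h) set" where
  "H2_ball = {f \<in> extensional nc_ball.
     free_holomorphic f \<and> (\<lambda>\<alpha>. (cmod (free_coeff f \<alpha>))\<^sup>2) summable_on UNIV}"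

definition H2_norm :: "(('h::complex_hilbert \<Rightarrow>\<^sub>L 'h) ^ 'n \<Rightarrow> 'h \<Rightarrow>\<^sub>L 'h) \<Rightarrow> real" where
  "H2_norm f = sqrt (\<Sum>\<^sub>\<infinity>\<alpha>. (cmod (free_coeff f \<alpha>))\<^sup>2)"

definition H2_lincomb ::
    "complex \<Rightarrow> (('h::complex_hilbert \<Rightarrow>\<^sub>L 'h) ^ 'n \<Rightarrow> 'h \<Rightarrow>\<^sub>L 'h) \<Rightarrow>
     complex \<Rightarrow> (('h \<Rightarrow>\<^sub>L 'h) ^ 'n \<Rightarrow> 'h \<Rightarrow>\<^sub>L 'h) \<Rightarrow> ('h \<Rightarrow>\<^sub>L 'h) ^ 'n \<Rightarrow> 'h \<Rightarrow>\<^sub>L 'h" where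
  "H2_lincomb c f d g = (\<lambda>X\<in>nc_ball. (scalar_op c o\<^sub>L f X) + (scalar_op d o\<^sub>L g X))"

definition H2_topology :: "(('h::complex_hilbert \<Rightarrow>\<^sub>L 'h) ^ 'n \<Rightarrow> 'h \<Rightarrow>\<^sub>L 'h) topology" where
  "H2_topology = Metric_space.mtopology H2_ball (\<lambda>f g. H2_norm (H2_lincomb 1 f (-1) g))"

definition H2_compact_operator ::
    "((('h::complex_hilbert \<Rightarrow>\<^sub>L 'h) ^ 'n \<Rightarrow> 'h \<Rightarrow>\<^sub>L 'h) \<Rightarrow> (('h \<Rightarrow>\<^sub>L 'h) ^ 'n \<Rightarrow> 'h \<Rightarrow>\<^sub>L 'h)) \<Rightarrow> bool"
  where
  "H2_compact_operator T \<longleftrightarrow>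
     T \<in> H2_ball \<rightarrow> H2_ball \<and>
     (\<forall>f\<in>H2_ball. \<forall>g\<in>H2_ball. \<forall>c d.
        T (H2_lincomb c f d g) = H2_lincomb c (T f) d (T g)) \<and>
     compactin H2_topology (H2_topology closure_of (T ` {f \<in> H2_ball. H2_norm f \<le> 1}))"

text \<open>For \<open>f\<close> with coefficients \<open>a\<close>, the value \<open>f (\<phi> X)\<close> is the sum of the series
  \<open>\<Sum>k. \<Sum>|\<alpha>| = k. a\<^sub>\<alpha> \<phi>\<^sub>\<alpha>(X)\<close>, because \<open>\<phi> X\<close> lies in the ball again.\<close>

definition comp_op ::
    "(('h::complex_hilbert \<Rightarrow>\<^sub>L 'h) ^ 'n \<Rightarrow> ('h \<Rightarrow>\<^sub>L 'h) ^ 'n) \<Rightarrow>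
     (('h \<Rightarrow>\<^sub>L 'h) ^ 'n \<Rightarrow> 'h \<Rightarrow>\<^sub>L 'h) \<Rightarrow> ('h \<Rightarrow>\<^sub>L 'h) ^ 'n \<Rightarrow> 'h \<Rightarrow>\<^sub>L 'h" where
  "comp_op \<phi> f = (\<lambda>X\<in>nc_ball. f (\<phi> X))"

section \<open>Scalar representation\<close>

definition scalar_tuple :: "complex ^ 'n \<Rightarrow> ('h::complex_hilbert \<Rightarrow>\<^sub>L 'h) ^ 'n" where
  "scalar_tuple z = (\<chi> i. scalar_op (z $ i))"

definition scalar_rep ::
    "(('h::complex_hilbert \<Rightarrow>\<^sub>L 'h) ^ 'n \<Rightarrow> ('h \<Rightarrow>\<^sub>L 'h) ^ 'n) \<Rightarrow> complex ^ 'n \<Rightarrow> complex ^ 'n" where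
  "scalar_rep \<phi> z = (THE w. \<phi> (scalar_tuple z) = scalar_tuple w)"

lemma row_scalar_tuple:
  "(\<Sum>i\<in>UNIV. scalar_tuple z $ i o\<^sub>L op_adjoint (scalar_tuple z $ i)) =
     scalar_op (complex_of_real ((norm z)\<^sup>2))"
  by (simp only: norm_power2_vec) 
    (simp add: scalar_tuple_def op_adjoint_scalar_op scalar_op_mult scalar_op_sum)

lemma scalar_tuple_in_nc_ball:
  fixes z :: "complex ^ 'n"
  assumes "norm z < 1"
  shows "(scalar_tuple z :: ('h::complex_hilbert \<Rightarrow>\<^sub>L 'h) ^ 'n) \<in> nc_ball"
proof -
  have "norm (scalar_op (complex_of_real ((norm z)\<^sup>2)) :: 'h \<Rightarrow>\<^sub>L 'h) \<le> (norm z)\<^sup>2"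
    using norm_scalar_op_le[of "complex_of_real ((norm z)\<^sup>2)"] by (simp del: of_real_power)
  also have "\<dots> < 1"
    using assms by (simp add: abs_square_less_1)
  finally have "sqrt (norm (\<Sum>i\<in>UNIV. (scalar_tuple z :: ('h \<Rightarrow>\<^sub>L 'h) ^ 'n) $ i o\<^sub>L op_adjoint (scalar_tuple z $ i))) < 1"
    unfolding row_scalar_tuple by simp
  moreover have "(scalar_tuple z :: ('h \<Rightarrow>\<^sub>L 'h) ^ 'n) $ i \<in> bounded_ops" for i
    by (simp add: scalar_tuple_def bounded_ops_def scaleC_scaleC mult.commute)
  ultimately show ?thesis
    by (simp add: nc_ball_def)
qed

lemma word_op_scalar_tuple: "word_op (scalar_tuple z) \<alpha> \<in> range scalar_op"
proof (induction \<alpha>)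
  case Nil
  then show ?case
    by (simp add: word_op_def flip: scalar_op_1)
next
  case (Cons i \<alpha>)
  then show ?case
    by (auto simp: word_op_def scalar_tuple_def scalar_op_mult)
qed

lemma free_holomorphic_scalar_tuple:
  fixes f :: "('h::complex_hilbert \<Rightarrow>\<^sub>L 'h) ^ 'n \<Rightarrow> 'h \<Rightarrow>\<^sub>L 'h"
  assumes "free_holomorphic f" "norm z < 1"
  shows "f (scalar_tuple z) \<in> range scalar_op"
proof -
  obtain a where a: "has_free_expansion f a"
    using assms(1) by (auto simp: free_holomorphic_def)
  have "\<forall>\<alpha>. \<exists>c. word_op (scalar_tuple z :: ('h \<Rightarrow>\<^sub>L 'h) ^ 'n) \<alpha> = scalar_op c"
    using word_op_scalar_tuple[of z] by blast
  from choice[OF this] obtain w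
    where w: "\<And>\<alpha>. word_op (scalar_tuple z :: ('h \<Rightarrow>\<^sub>L 'h) ^ 'n) \<alpha> = scalar_op (w \<alpha>)"
    by blast
  have "(\<lambda>k. \<Sum>\<alpha> | length \<alpha> = k. scalar_op (a \<alpha>) o\<^sub>L word_op (scalar_tuple z) \<alpha>) sums
      f (scalar_tuple z)"
    using a scalar_tuple_in_nc_ball[OF assms(2)] by (auto simp: has_free_expansion_def)
  then have "(\<lambda>n. scalar_op (\<Sum>k<n. \<Sum>\<alpha> | length \<alpha> = k. a \<alpha> * w \<alpha>)) \<longlonglongrightarrow> f (scalar_tuple z)"
    by (simp add: sums_def w scalar_op_mult scalar_op_sum)
  then show ?thesis
    by (rule closed_sequentially[OF closed_range_scalar_op, rotated]) simp
qed

text \<open>The scalar representation is well defined.\<close>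

lemma scalar_rep_exists:
  assumes "free_holomorphic_self_map \<phi>" "norm z < 1"
  shows "\<exists>w. \<phi> (scalar_tuple z) = scalar_tuple w"
proof -
  have "\<phi> (scalar_tuple z) $ i \<in> range scalar_op" for i
    using free_holomorphic_scalar_tuple[of "\<lambda>X. \<phi> X $ i"] assms
    by (auto simp: free_holomorphic_self_map_def)
  then have "\<forall>i. \<exists>c. \<phi> (scalar_tuple z) $ i = scalar_op c"
    by blast
  from choice[OF this] obtain w where "\<And>i. \<phi> (scalar_tuple z) $ i = scalar_op (w i)"
    by blast
  then have "\<phi> (scalar_tuple z) = scalar_tuple (\<chi> i. w i)"
    by (simp add: vec_eq_iff scalar_tuple_def)
  then show ?thesis
    by blast
qed

lemma scalar_rep_eq:
  fixes \<phi> :: "('h::complex_hilbert \<Rightarrow>\<^sub>L 'h) ^ 'n \<Rightarrow> ('h \<Rightarrow>\<^sub>L 'h) ^ 'n"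
  assumes "free_holomorphic_self_map \<phi>" "norm z < 1" and x: "(x :: 'h) \<noteq> 0"
  shows "\<phi> (scalar_tuple z) = scalar_tuple (scalar_rep \<phi> z)"
proof -
  have "v = w" if "scalar_tuple v = (scalar_tuple w :: ('h \<Rightarrow>\<^sub>L 'h) ^ 'n)" for v w
  proof -
    have "v $ i = w $ i" for i
    proof -
      have eq: "scalar_op (v $ i) = (scalar_op (w $ i) :: 'h \<Rightarrow>\<^sub>L 'h)"
        using that by (simp add: scalar_tuple_def vec_eq_iff)
      have "scalar_op (v $ i - w $ i) + scalar_op (w $ i) = (scalar_op (v $ i) :: 'h \<Rightarrow>\<^sub>L 'h)"
        by (simp flip: scalar_op_add)
      then have "scalar_op (v $ i - w $ i) = (0 :: 'h \<Rightarrow>\<^sub>L 'h)"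
        using eq by simp
      then show ?thesis
        using norm_scalar_op[OF x, of "v $ i - w $ i"] by simp
    qed
    then show ?thesis
      by (simp add: vec_eq_iff)
  qed
  then have "\<exists>!w. \<phi> (scalar_tuple z) = scalar_tuple w"
    using scalar_rep_exists[OF assms(1,2)] by metis
  then show ?thesis
    unfolding scalar_rep_def by (rule theI')
qed

definition holomorphic_map_on :: "(complex ^ 'm \<Rightarrow> complex ^ 'n) \<Rightarrow> (complex ^ 'm) set \<Rightarrow> bool" where
  "holomorphic_map_on F S \<longleftrightarrow>
     (\<forall>z\<in>S. \<exists>D. (F has_derivative D) (at z) \<and> (\<forall>c v. D (c *s v) = c *s D v))"

end

(* Write psi for the scalar representation. The Szegoe kernel at w in the unit ball has norm
   (1 - |w|^2)^(-1/2) and the adjoint of the composition operator maps the kernel at z to the kernel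
   at psi(z). Normalised kernels tend weakly to 0 at the boundary, so compactness forces
   (1 - |z|^2) / (1 - |psi(z)|^2) -> 0 as |z| -> 1. Truncating psi radially to a ball of radius
   R close to 1, Brouwer's theorem yields a fixed point; one on the sphere |z| = R would have
   |psi(z)| > |z|, which the limit excludes. If psi had two fixed points, then by Schwarz--Pick on the
   slice through them the above quotient would stay bounded below on that slice up to the boundary. *)

theory Submission
  imports Defs "HOL-Complex_Analysis.Complex_Analysis"
begin

section \<open>Uniqueness of the coefficients\<close>

text \<open>The Hardy norm is read off from \<open>free_coeff\<close>, so it can be computed only
  once coefficients are known to be unique. Scalar points cannot show this, since words that are
  permutations of each other take equal values there; genuinely noncommuting operators are needed,
  and the orthonormal vectors on which they act exist because the space is infinite dimensional.
  Adjoints and weak limits on the Hardy space are avoided. A test function imitating a kernel makes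
  its image under composition large at z, while a fixed norm limit of such images grows more slowly
  than (1 - |z|^2)^(-1/2): finitely many coefficients contribute a bounded amount, and the remaining
  ones have small norm. In the uniqueness argument the complex line through two fixed points need
  not contain 0 and need not be mapped into itself. A holomorphic retraction onto the slice restores
  a self-map of a disc, and it distorts the distance to the sphere by at most a factor that depends
  on the slice alone.\<close>

lemma cinner_add_right: "cinner x (y + z) = cinner x y + cinner x (z :: 'h::complex_hilbert)"
  by (metis cinner_add_left cinner_commute complex_cnj_add)

lemma cinner_zero_left [simp]: "cinner 0 (y :: 'h::complex_hilbert) = 0"
  using cinner_add_left[of 0 0 y] by simp

lemma cinner_zero_right [simp]: "cinner (x :: 'h::complex_hilbert) 0 = 0"
  using cinner_add_right[of x 0 0] by simp

lemma cinner_sum_left: "cinner (\<Sum>i\<in>A. f i) (y :: 'h::complex_hilbert) = (\<Sum>i\<in>A. cinner (f i) y)"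
  by (induction A rule: infinite_finite_induct) (simp_all add: cinner_add_left)

lemma cinner_sum_right: "cinner (x :: 'h::complex_hilbert) (\<Sum>i\<in>A. f i) = (\<Sum>i\<in>A. cinner x (f i))"
  by (induction A rule: infinite_finite_induct) (simp_all add: cinner_add_right)

lemma cinner_scaleR_left: "cinner (r *\<^sub>R x) (y :: 'h::complex_hilbert) = r * cinner x y"
  by (metis cinner_scaleC_left scaleC_of_real)

lemma cinner_scaleR_right: "cinner (x :: 'h::complex_hilbert) (r *\<^sub>R y) = r * cinner x y"
  by (metis cinner_scaleC_right scaleC_of_real complex_cnj_complex_of_real)

lemma cinner_diff_left: "cinner (x - y) (z :: 'h::complex_hilbert) = cinner x z - cinner y z"
  using cinner_add_left[of "x - y" y z] by simp

lemma cinner_self: "cinner x (x :: 'h::complex_hilbert) = (norm x)\<^sup>2"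
proof -
  have "Im (cinner x x) = 0"
    using arg_cong[OF cinner_commute[of x x], of Im] by simp
  then show ?thesis
    by (simp add: complex_eq_iff Re_cinner power2_norm_eq_inner)
qed

text \<open>The real inner product sees only the real part of \<open>cinner\<close>. Multiplying
  \<open>x\<close> by the conjugate phase of \<open>cinner x y\<close> makes that value real and
  nonnegative, and then the real Cauchy-Schwarz inequality applies.\<close>

lemma cmod_cinner_le: "cmod (cinner x y) \<le> norm x * norm (y :: 'h::complex_hilbert)"
proof -
  define c where "c = cnj (sgn (cinner x y))"
  have "c * cinner x y = cmod (cinner x y)"
    unfolding c_def sgn_eq by (simp add: complex_norm_square[symmetric] power2_eq_square mult.commute)
  then have "cmod (cinner x y) = inner (c *\<^sub>C x) y"
    by (metis Re_cinner Re_complex_of_real cinner_scaleC_left)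
  also have "\<dots> \<le> norm (c *\<^sub>C x) * norm y"
    by (rule norm_cauchy_schwarz)
  also have "\<dots> \<le> norm x * norm y"
    by (intro mult_right_mono) (auto simp: norm_scaleC c_def norm_sgn)
  finally show ?thesis .
qed

text \<open>Gram-Schmidt along the index set: by infinite dimension the span of the vectors already
  chosen is never everything. The index type is arbitrary so that words can label the
  vectors.\<close>

lemma exists_orthonormal:
  assumes inf: "\<not> (\<exists>B :: 'h::complex_hilbert set. finite B \<and> module.span (*\<^sub>C) B = UNIV)"
    and "finite A"
  shows "\<exists>e :: 'a \<Rightarrow> 'h. \<forall>a\<in>A. \<forall>b\<in>A. cinner (e a) (e b) = (if a = b then 1 else 0)"
  using \<open>finite A\<close>
proof induction
  case (insert k A)
  interpret V: vector_space "(*\<^sub>C) :: complex \<Rightarrow> 'h \<Rightarrow> 'h"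
    by (rule vector_space_scaleC)
  from insert obtain e :: "'a \<Rightarrow> 'h"
    where e: "\<And>a b. a \<in> A \<Longrightarrow> b \<in> A \<Longrightarrow> cinner (e a) (e b) = (if a = b then 1 else 0)"
    by blast
  obtain x where x: "x \<notin> V.span (e ` A)"
    using inf insert.hyps by blast
  define p where "p = (\<Sum>a\<in>A. cinner x (e a) *\<^sub>C e a)"
  have "p \<in> V.span (e ` A)"
    unfolding p_def by (intro V.span_sum V.span_scale V.span_base) auto
  with x have y0: "x - p \<noteq> 0"
    by auto
  have orth: "cinner (x - p) (e b) = 0" if "b \<in> A" for b
    using that insert.hyps
    by (simp add: cinner_diff_left p_def cinner_sum_left cinner_scaleC_left e if_distrib
        sum.delta cong: if_cong)
  have orth': "cinner (e b) (x - p) = 0" if "b \<in> A" for b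
    using orth[OF that] by (metis cinner_commute complex_cnj_zero)
  show ?case
  proof (intro exI[of _ "e(k := (1 / norm (x - p)) *\<^sub>R (x - p))"] ballI)
    fix a b assume "a \<in> insert k A" "b \<in> insert k A"
    then show "cinner ((e(k := (1 / norm (x - p)) *\<^sub>R (x - p))) a)
        ((e(k := (1 / norm (x - p)) *\<^sub>R (x - p))) b) = (if a = b then 1 else 0)"
      using insert.hyps e orth orth' y0
      by (auto simp: cinner_scaleR_left cinner_scaleR_right cinner_self[of "x - p"] power2_eq_square)
  qed
qed simp

section \<open>Finite rank operators, truncated creation operators and coefficient
  extraction\<close>

text \<open>For finite sums of rank-one operators the adjoint is explicit: exchange the two
  families. This evaluates the description in \<open>op_adjoint\<close> without a general existence
  theorem for adjoints.\<close>

definition rank_sum :: "'a set \<Rightarrow> ('a \<Rightarrow> 'h) \<Rightarrow> ('a \<Rightarrow> 'h) \<Rightarrow> 'h::complex_hilbert \<Rightarrow>\<^sub>L 'h" where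
  "rank_sum A u v = Blinfun (\<lambda>x. \<Sum>a\<in>A. cinner x (u a) *\<^sub>C v a)"

lemma rank_sum_apply:
  "blinfun_apply (rank_sum A u v) x = (\<Sum>a\<in>A. cinner x (u a) *\<^sub>C v a)"
proof -
  have "bounded_linear (\<lambda>x. cinner x (u a) *\<^sub>C v a)" for a
  proof (rule bounded_linear_intro[of _ "norm (u a) * norm (v a)"])
    show "norm (cinner x (u a) *\<^sub>C v a) \<le> norm x * (norm (u a) * norm (v a))" for x
      using mult_right_mono[OF cmod_cinner_le[of x "u a"], of "norm (v a)"]
      by (simp add: norm_scaleC mult_ac)
  qed (simp_all add: cinner_add_left scaleC_add_left cinner_scaleC_left flip: scaleC_scaleC scaleC_of_real)
  then have "bounded_linear (\<lambda>x. \<Sum>a\<in>A. cinner x (u a) *\<^sub>C v a)"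
    by (intro bounded_linear_sum)
  then show ?thesis
    by (simp add: rank_sum_def bounded_linear_Blinfun_apply)
qed

lemma op_adjoint_rank_sum: "op_adjoint (r *\<^sub>R rank_sum A u v) = r *\<^sub>R rank_sum A v u"
  unfolding op_adjoint_def
proof (rule the_equality)
  have "cinner (\<Sum>a\<in>A. cinner x (u a) *\<^sub>C v a) y = cinner x (\<Sum>a\<in>A. cinner y (v a) *\<^sub>C u a)" for x y
    by (simp add: cinner_sum_left cinner_sum_right cinner_scaleC_left cinner_scaleC_right
        mult.commute flip: cinner_commute)
  then show *: "\<forall>x y. cinner (blinfun_apply (r *\<^sub>R rank_sum A u v) x) y =
      cinner x (blinfun_apply (r *\<^sub>R rank_sum A v u) y)"
    by (simp add: blinfun.scaleR_left cinner_scaleR_left cinner_scaleR_right rank_sum_apply)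
  fix S assume S: "\<forall>x y. cinner (blinfun_apply (r *\<^sub>R rank_sum A u v) x) y = cinner x (blinfun_apply S y)"
  show "S = r *\<^sub>R rank_sum A v u"
  proof (rule blinfun_eqI)
    fix y
    have "inner x (blinfun_apply S y) = inner x (blinfun_apply (r *\<^sub>R rank_sum A v u) y)" for x
      using S * by (metis Re_cinner)
    then show "blinfun_apply S y = blinfun_apply (r *\<^sub>R rank_sum A v u) y"
      by (metis vector_eq_ldot)
  qed
qed

lemma finite_words [simp]: "finite {\<alpha> :: 'n::finite list. length \<alpha> = k}"
  using finite_lists_length_eq[of "UNIV :: 'n set" k] by simp

lemma finite_words_le [simp]: "finite {\<alpha> :: 'n::finite list. length \<alpha> \<le> k}"
  using finite_lists_length_le[of "UNIV :: 'n set" k] by simp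

lemma finite_words_less [simp]: "finite {\<alpha> :: 'n::finite list. length \<alpha> < k}"
  by (rule finite_subset[OF _ finite_words_le[of k]]) auto

text \<open>Coefficients are read off from the compression of the (scaled) left creation operators
  to the words of length at most \<open>m\<close>; scaling places this tuple in the ball.\<close>

lemma exists_creation_tuple:
  assumes inf: "\<not> (\<exists>B :: 'h::complex_hilbert set. finite B \<and> module.span (*\<^sub>C) B = UNIV)"
  shows "\<exists>(X :: ('h \<Rightarrow>\<^sub>L 'h) ^ 'n) e r. X \<in> nc_ball \<and> r > (0::real) \<and>
    (\<forall>\<alpha> \<beta>. length \<alpha> \<le> m \<longrightarrow> length \<beta> \<le> m \<longrightarrow> cinner (e \<alpha>) (e \<beta>) = (if \<alpha> = \<beta> then 1 else 0)) \<and>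
    (\<forall>\<alpha>. blinfun_apply (word_op X \<alpha>) (e []) = (if length \<alpha> \<le> m then r ^ length \<alpha> *\<^sub>R e \<alpha> else 0))"
proof -
  obtain e :: "'n list \<Rightarrow> 'h" where
    "\<forall>\<alpha>\<in>{\<alpha>. length \<alpha> \<le> m}. \<forall>\<beta>\<in>{\<alpha>. length \<alpha> \<le> m}. cinner (e \<alpha>) (e \<beta>) = (if \<alpha> = \<beta> then 1 else 0)"
    using exists_orthonormal[OF inf finite_words_le[where 'n='n, of m]] by blast
  then have e: "cinner (e \<alpha>) (e \<beta>) = (if \<alpha> = \<beta> then 1 else 0)" if "length \<alpha> \<le> m" "length \<beta> \<le> m" for \<alpha> \<beta>
    using that by simp
  \<comment> \<open>Strictly shorter words only: then i # \<alpha> still has length at most m, where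
    the family is orthonormal, and words of length m are sent to 0.\<close>
  let ?W = "{\<alpha> :: 'n list. length \<alpha> < m}"
  define V where "V i = rank_sum ?W e (\<lambda>\<alpha>. e (i # \<alpha>))" for i
  define V' where "V' i = rank_sum ?W (\<lambda>\<alpha>. e (i # \<alpha>)) e" for i
  define C where "C = norm (\<Sum>i\<in>UNIV. V i o\<^sub>L V' i)"
  \<comment> \<open>Any positive r with r^2 C < 1 puts the scaled tuple into the ball; this one also
    covers C = 0.\<close>
  define r where "r = 1 / (1 + C)"
  have C: "C \<ge> 0"
    by (simp add: C_def)
  then have r: "r > 0"
    by (simp add: r_def)
  have rC: "r\<^sup>2 * C < 1"
  proof -
    have "C < (1 + C)\<^sup>2"
      using C by (simp add: power2_eq_square algebra_simps) (smt (verit) mult_nonneg_nonneg)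
    then show ?thesis
      using C by (simp add: r_def power_divide divide_simps)
  qed
  define X :: "('h \<Rightarrow>\<^sub>L 'h) ^ 'n" where "X = (\<chi> i. r *\<^sub>R V i)"
  have adj: "op_adjoint (X $ i) = r *\<^sub>R V' i" for i
    by (simp add: X_def V_def V'_def op_adjoint_rank_sum)
  have "X $ i o\<^sub>L op_adjoint (X $ i) = r\<^sup>2 *\<^sub>R (V i o\<^sub>L V' i)" for i
    unfolding adj
    by (rule blinfun_eqI)
      (simp add: X_def blinfun.scaleR_left blinfun.scaleR_right power2_eq_square)
  then have "(\<Sum>i\<in>UNIV. X $ i o\<^sub>L op_adjoint (X $ i)) = r\<^sup>2 *\<^sub>R (\<Sum>i\<in>UNIV. V i o\<^sub>L V' i)"
    by (simp add: scaleR_sum_right)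
  then have "norm (\<Sum>i\<in>UNIV. X $ i o\<^sub>L op_adjoint (X $ i)) < 1"
    using rC by (simp add: C_def)
  moreover have "X $ i \<in> bounded_ops" for i
  proof -
    interpret Vs: vector_space "(*\<^sub>C) :: complex \<Rightarrow> 'h \<Rightarrow> 'h"
      by (rule vector_space_scaleC)
    have "c *\<^sub>C r *\<^sub>R x = r *\<^sub>R c *\<^sub>C x" for c and x :: 'h
      by (simp add: scaleC_scaleC mult.commute flip: scaleC_of_real)
    then show ?thesis
      by (simp add: bounded_ops_def X_def V_def blinfun.scaleR_left rank_sum_apply
          cinner_scaleC_left Vs.scale_sum_right)
  qed
  ultimately have X: "X \<in> nc_ball"
    by (simp add: nc_ball_def)
  have step: "blinfun_apply (X $ i) (e \<alpha>) = (if length \<alpha> < m then r *\<^sub>R e (i # \<alpha>) else 0)"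
    if "length \<alpha> \<le> m" for i \<alpha>
  proof -
    have one: "1 *\<^sub>C x = x" and nul: "0 *\<^sub>C x = 0" for x :: 'h
      using scaleC_of_real[of 1 x] scaleC_of_real[of 0 x] by simp_all
    have "blinfun_apply (V i) (e \<alpha>) = (\<Sum>\<beta>\<in>?W. if \<alpha> = \<beta> then e (i # \<beta>) else 0)"
      unfolding V_def rank_sum_apply using that by (intro sum.cong) (auto simp: e one nul)
    then show ?thesis
      by (simp add: X_def blinfun.scaleR_left)
  qed
  have "blinfun_apply (word_op X \<alpha>) (e []) = (if length \<alpha> \<le> m then r ^ length \<alpha> *\<^sub>R e \<alpha> else 0)" for \<alpha>
  proof (induction \<alpha>)
    case (Cons i \<alpha>)
    have "blinfun_apply (word_op X (i # \<alpha>)) (e []) = blinfun_apply (X $ i) (blinfun_apply (word_op X \<alpha>) (e []))"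
      by (simp add: word_op_def)
    then show ?case
      using Cons step[of \<alpha> i] by (auto simp: blinfun.scaleR_right)
  qed (simp add: word_op_def)
  with X r e show ?thesis
    by blast
qed

text \<open>On the truncated creation tuple, f X sends the vacuum vector \<open>e []\<close> to a
  combination of orthonormal vectors \<open>e \<alpha>\<close>, so the inner product with
  \<open>e \<beta>\<close> isolates one coefficient up to a nonzero power of r.\<close>

lemma free_expansion_unique:
  fixes f :: "('h::complex_hilbert \<Rightarrow>\<^sub>L 'h) ^ 'n \<Rightarrow> 'h \<Rightarrow>\<^sub>L 'h"
  assumes inf: "\<not> (\<exists>B :: 'h set. finite B \<and> module.span (*\<^sub>C) B = UNIV)"
    and a: "has_free_expansion f a" and b: "has_free_expansion f b"
  shows "a = b"
proof
  fix \<beta> :: "'n list"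
  obtain X :: "('h \<Rightarrow>\<^sub>L 'h) ^ 'n" and e and r :: real where X: "X \<in> nc_ball" and r: "r > 0"
    and e: "\<And>\<alpha> \<gamma>. length \<alpha> \<le> length \<beta> \<Longrightarrow> length \<gamma> \<le> length \<beta> \<Longrightarrow>
        cinner (e \<alpha>) (e \<gamma>) = (if \<alpha> = \<gamma> then 1 else 0)"
    and w: "\<And>\<alpha>. blinfun_apply (word_op X \<alpha>) (e []) =
        (if length \<alpha> \<le> length \<beta> then r ^ length \<alpha> *\<^sub>R e \<alpha> else 0)"
    using exists_creation_tuple[OF inf, of "length \<beta>"] by blast
  have "cinner (blinfun_apply (f X) (e [])) (e \<beta>) = c \<beta> * r ^ length \<beta>"
    if c: "has_free_expansion f c" for c
  proof -
    let ?S = "{\<alpha> :: 'n list. length \<alpha> = length \<beta>}"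
    have nul: "c *\<^sub>C (0::'h) = 0" for c
      by (metis mult_zero_right norm_eq_zero norm_scaleC norm_zero)
    let ?t = "\<lambda>k. \<Sum>\<alpha> | length \<alpha> = k. c \<alpha> *\<^sub>C (if k \<le> length \<beta> then r ^ k *\<^sub>R e \<alpha> else 0)"
    have "(\<lambda>k. \<Sum>\<alpha> | length \<alpha> = k. scalar_op (c \<alpha>) o\<^sub>L word_op X \<alpha>) sums f X"
      using c X by (simp add: has_free_expansion_def)
    then have "(\<lambda>k. blinfun_apply (\<Sum>\<alpha> | length \<alpha> = k. scalar_op (c \<alpha>) o\<^sub>L word_op X \<alpha>) (e []))
        sums blinfun_apply (f X) (e [])"
      by (rule bounded_linear.sums[OF blinfun.bounded_linear_left])
    also have "(\<lambda>k. blinfun_apply (\<Sum>\<alpha> | length \<alpha> = k. scalar_op (c \<alpha>) o\<^sub>L word_op X \<alpha>) (e [])) = ?t"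
      by (auto simp: blinfun.sum_left w intro!: sum.cong)
    finally have "?t sums blinfun_apply (f X) (e [])" .
    \<comment> \<open>The tuple annihilates the vacuum along every word longer than \<beta>, so the
      series is a finite sum.\<close>
    moreover have "?t sums (\<Sum>k\<le>length \<beta>. ?t k)"
      by (rule sums_finite) (auto simp: nul)
    ultimately have "blinfun_apply (f X) (e []) = (\<Sum>k\<le>length \<beta>. ?t k)"
      by (rule sums_unique2)
    then have "cinner (blinfun_apply (f X) (e [])) (e \<beta>) =
        (\<Sum>k\<le>length \<beta>. \<Sum>\<alpha> | length \<alpha> = k. c \<alpha> * (r ^ k * (if \<alpha> = \<beta> then 1 else 0)))"
      by (auto simp: cinner_sum_left cinner_scaleC_left cinner_scaleR_left e intro!: sum.cong)
    also have "\<dots> = (\<Sum>k\<le>length \<beta>. if k = length \<beta> then c \<beta> * r ^ k else 0)"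
      by (intro sum.cong refl) (auto simp: if_distrib cong: if_cong)
    finally show ?thesis
      by simp
  qed
  from this[OF a] this[OF b] r show "a \<beta> = b \<beta>"
    by simp
qed

lemma free_coeff_eq:
  fixes f :: "('h::complex_hilbert \<Rightarrow>\<^sub>L 'h) ^ 'n \<Rightarrow> 'h \<Rightarrow>\<^sub>L 'h"
  assumes inf: "\<not> (\<exists>B :: 'h set. finite B \<and> module.span (*\<^sub>C) B = UNIV)"
    and a: "has_free_expansion f a"
  shows "free_coeff f = a"
  unfolding free_coeff_def using a free_expansion_unique[OF inf _ a] by blast

section \<open>Homogeneous expansions at scalar points\<close>

definition word_eval :: "complex ^ 'n \<Rightarrow> 'n list \<Rightarrow> complex" where
  "word_eval z \<alpha> = (\<Prod>i\<leftarrow>\<alpha>. z $ i)"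

lemma word_eval_simps [simp]:
  "word_eval z [] = 1" "word_eval z (i # \<alpha>) = z $ i * word_eval z \<alpha>"
  by (simp_all add: word_eval_def)

lemma word_op_scalar_tuple_eq: "word_op (scalar_tuple z) \<alpha> = scalar_op (word_eval z \<alpha>)"
  by (induction \<alpha>) (simp_all add: word_op_def scalar_tuple_def scalar_op_mult scalar_op_1)

lemma sum_words_Suc:
  "(\<Sum>\<alpha> | length \<alpha> = Suc k. f (\<alpha> :: 'n::finite list)) = (\<Sum>i\<in>UNIV. \<Sum>\<alpha> | length \<alpha> = k. f (i # \<alpha>))"
proof -
  have "{\<alpha> :: 'n list. length \<alpha> = Suc k} = (\<lambda>(i, \<alpha>). i # \<alpha>) ` (UNIV \<times> {\<alpha>. length \<alpha> = k})"
    by (force simp: length_Suc_conv)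
  moreover have "inj_on (\<lambda>(i, \<alpha>). i # \<alpha>) (UNIV \<times> {\<alpha> :: 'n list. length \<alpha> = k})"
    by (auto simp: inj_on_def)
  ultimately show ?thesis
    by (simp add: sum.reindex sum.cartesian_product case_prod_unfold)
qed

lemma sum_words_less:
  "(\<Sum>\<alpha> | length \<alpha> < m. f (\<alpha> :: 'n::finite list)) = (\<Sum>k<m. \<Sum>\<alpha> | length \<alpha> = k. f \<alpha>)"
proof -
  have "(\<Sum>k<m. \<Sum>\<alpha> | length \<alpha> = k. f \<alpha>) = sum f (\<Union>k\<in>{..<m}. {\<alpha> :: 'n list. length \<alpha> = k})"
    by (subst sum.UNION_disjoint) auto
  also have "(\<Union>k\<in>{..<m}. {\<alpha> :: 'n list. length \<alpha> = k}) = {\<alpha>. length \<alpha> < m}"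
    by auto
  finally show ?thesis ..
qed

lemma sum_UNIV_norm_sq: "(\<Sum>i\<in>UNIV. (cmod (z $ i))\<^sup>2) = (norm (z :: complex ^ 'n))\<^sup>2"
  by (simp add: norm_vec_def L2_set_def sum_nonneg)

text \<open>Expanding (|z_1|^2 + ... + |z_n|^2)^k by words produces each product once, so no
  multinomial coefficients arise. Summed over k this is the squared norm of the Szegoe
  kernel.\<close>

lemma sum_word_eval_sq:
  "(\<Sum>\<alpha> | length \<alpha> = k. (cmod (word_eval z \<alpha>))\<^sup>2) = (norm (z :: complex ^ 'n)) ^ (2 * k)"
proof (induction k)
  case (Suc k)
  have "(\<Sum>\<alpha> | length \<alpha> = Suc k. (cmod (word_eval z \<alpha>))\<^sup>2) =
      (\<Sum>i\<in>UNIV. (cmod (z $ i))\<^sup>2 * (norm z) ^ (2 * k))"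
    by (simp add: sum_words_Suc norm_mult power_mult_distrib flip: sum_distrib_left Suc)
  also have "\<dots> = (norm z)\<^sup>2 * (norm z) ^ (2 * k)"
    by (simp only: sum_UNIV_norm_sq flip: sum_distrib_right)
  finally show ?case
    by (simp add: power2_eq_square)
qed simp

lemma L2_word_eval: "L2_set (\<lambda>\<alpha>. cmod (word_eval z \<alpha>)) {\<alpha>. length \<alpha> = k} = norm (z :: complex ^ 'n) ^ k"
  by (simp add: L2_set_def sum_word_eval_sq power_even_eq)

lemma norm_sum_mult_le_L2:
  fixes f g :: "'a \<Rightarrow> complex"
  shows "cmod (\<Sum>i\<in>A. f i * g i) \<le> L2_set (\<lambda>i. cmod (f i)) A * L2_set (\<lambda>i. cmod (g i)) A"
proof -
  have "cmod (\<Sum>i\<in>A. f i * g i) \<le> (\<Sum>i\<in>A. \<bar>cmod (f i)\<bar> * \<bar>cmod (g i)\<bar>)"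
    by (rule order_trans[OF norm_sum]) (simp add: norm_mult)
  also have "\<dots> \<le> L2_set (\<lambda>i. cmod (f i)) A * L2_set (\<lambda>i. cmod (g i)) A"
    by (rule L2_set_mult_ineq)
  finally show ?thesis .
qed

section \<open>Termwise differentiation of homogeneous expansions\<close>

fun word_deriv :: "complex ^ 'n \<Rightarrow> complex ^ 'n \<Rightarrow> 'n list \<Rightarrow> complex" where
  "word_deriv z v [] = 0"
| "word_deriv z v (i # \<alpha>) = v $ i * word_eval z \<alpha> + z $ i * word_deriv z v \<alpha>"

lemma has_derivative_word_eval:
  "((\<lambda>z. word_eval z \<alpha>) has_derivative (\<lambda>v. word_deriv z v \<alpha>)) (at z within S)"
proof (induction \<alpha>)
  case (Cons i \<alpha>)
  have "((\<lambda>z. z $ i) has_derivative (\<lambda>v. v $ i)) (at z within S)"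
    by (rule bounded_linear.has_derivative[OF bounded_linear_vec_nth]) (rule has_derivative_ident)
  from has_derivative_mult[OF this Cons] show ?case
    by (simp add: algebra_simps)
qed simp

lemma word_deriv_scale: "word_deriv z (c *s v) \<alpha> = c * word_deriv z v \<alpha>"
  by (induction \<alpha>) (simp_all add: algebra_simps)

lemma L2_words_Suc:
  "L2_set (\<lambda>\<alpha>. cmod (x \<alpha>)) {\<alpha> :: 'n::finite list. length \<alpha> = Suc k} =
   L2_set (\<lambda>(i, \<alpha>). cmod (x (i # \<alpha>))) (UNIV \<times> {\<alpha>. length \<alpha> = k})"
  by (simp add: L2_set_def sum_words_Suc sum.cartesian_product case_prod_unfold)

text \<open>Multiplicativity of the Hilbert norm on elementary tensors; prefixing one letter is
  tensoring with one more vector.\<close>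

lemma L2_prod:
  "L2_set (\<lambda>(i, \<alpha>). cmod (y $ i * x \<alpha>)) (UNIV \<times> A) = norm (y :: complex ^ 'n) * L2_set (\<lambda>\<alpha>. cmod (x \<alpha>)) A"
proof -
  have "(\<Sum>(i, \<alpha>)\<in>UNIV \<times> A. (cmod (y $ i * x \<alpha>))\<^sup>2) = (norm y)\<^sup>2 * (\<Sum>\<alpha>\<in>A. (cmod (x \<alpha>))\<^sup>2)"
    by (simp add: norm_mult power_mult_distrib sum_product flip: sum.cartesian_product sum_UNIV_norm_sq)
  then show ?thesis
    by (simp add: L2_set_def case_prod_unfold real_sqrt_mult)
qed

text \<open>The words of length k carry the k-th tensor power of z. Its derivative is a sum of k
  tensors in which one factor z is replaced by v, each of norm |z|^(k-1) |v|. The truncated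
  subtraction is harmless, as the factor k vanishes at 0.\<close>

lemma L2_word_deriv:
  "L2_set (\<lambda>\<alpha>. cmod (word_deriv z v \<alpha>)) {\<alpha>. length \<alpha> = k} \<le>
    k * norm (z :: complex ^ 'n) ^ (k - 1) * norm v"
proof (induction k)
  case (Suc k)
  let ?A = "UNIV \<times> {\<alpha> :: 'n list. length \<alpha> = k}"
  have "L2_set (\<lambda>\<alpha>. cmod (word_deriv z v \<alpha>)) {\<alpha>. length \<alpha> = Suc k} =
      L2_set (\<lambda>p. cmod (v $ fst p * word_eval z (snd p) + z $ fst p * word_deriv z v (snd p))) ?A"
    by (simp add: L2_words_Suc case_prod_unfold)
  also have "\<dots> \<le> L2_set (\<lambda>p. cmod (v $ fst p * word_eval z (snd p)) + cmod (z $ fst p * word_deriv z v (snd p))) ?A"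
    by (intro L2_set_mono norm_triangle_ineq) auto
  also have "\<dots> \<le> L2_set (\<lambda>p. cmod (v $ fst p * word_eval z (snd p))) ?A +
      L2_set (\<lambda>p. cmod (z $ fst p * word_deriv z v (snd p))) ?A"
    by (rule L2_set_triangle_ineq)
  also have "\<dots> = norm v * norm z ^ k + norm z * L2_set (\<lambda>\<alpha>. cmod (word_deriv z v \<alpha>)) {\<alpha>. length \<alpha> = k}"
    using L2_prod[of v "word_eval z" "{\<alpha>. length \<alpha> = k}"] L2_prod[of z "word_deriv z v" "{\<alpha>. length \<alpha> = k}"]
    by (simp add: L2_word_eval case_prod_unfold)
  also have "\<dots> \<le> norm v * norm z ^ k + norm z * (k * norm z ^ (k - 1) * norm v)"
    using Suc by (intro add_left_mono mult_left_mono) auto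
  also have "\<dots> = Suc k * norm z ^ k * norm v"
    by (cases k) (simp_all add: algebra_simps)
  finally show ?case
    by simp
qed simp

text \<open>The root test for the Euclidean norms of the levels; the exponent 2k accounts for both
  the k-th root and the square root in \<open>L2_set\<close>.\<close>

lemma sqrt_level_le:
  assumes "limsup (\<lambda>k. ereal (root (2 * k) (\<Sum>\<alpha> | length \<alpha> = k. (cmod (a (\<alpha> :: 'n::finite list)))\<^sup>2))) \<le> 1"
    and "1 < t"
  shows "\<forall>\<^sub>F k in sequentially. L2_set (\<lambda>\<alpha>. cmod (a \<alpha>)) {\<alpha>. length \<alpha> = k} \<le> t ^ k"
proof -
  let ?S = "\<lambda>k. \<Sum>\<alpha> | length \<alpha> = k. (cmod (a \<alpha>))\<^sup>2"
  have "limsup (\<lambda>k. ereal (root (2 * k) (?S k))) < ereal t"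
    using assms by (simp add: order_le_less_trans)
  then have "\<forall>\<^sub>F k in sequentially. ereal (root (2 * k) (?S k)) < ereal t"
    by (rule Limsup_lessD)
  then show ?thesis
    \<comment> \<open>Level 0 is left out because \<open>root 0\<close> is constantly 0.\<close>
    using eventually_gt_at_top[of 0]
  proof eventually_elim
    case (elim k)
    have nn: "?S k \<ge> 0"
      by (intro sum_nonneg) auto
    have "?S k = root (2 * k) (?S k) ^ (2 * k)"
      using elim nn by (simp add: real_root_pow_pos2)
    also have "\<dots> \<le> t ^ (2 * k)"
      using elim nn by (intro power_mono) auto
    finally have "sqrt (?S k) \<le> sqrt ((t ^ k)\<^sup>2)"
      by (simp only: power_even_eq real_sqrt_le_iff)
    then show ?case
      using assms(2) by (simp add: L2_set_def)
  qed
qed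

lemma summable_level:
  assumes "limsup (\<lambda>k. ereal (root (2 * k) (\<Sum>\<alpha> | length \<alpha> = k. (cmod (a (\<alpha> :: 'n::finite list)))\<^sup>2))) \<le> 1"
    and r: "0 < r" "r < 1"
  shows "summable (\<lambda>k. L2_set (\<lambda>\<alpha>. cmod (a \<alpha>)) {\<alpha>. length \<alpha> = k} * (real k * r ^ (k - 1)))"
proof -
  \<comment> \<open>This splits r evenly: t exceeds 1, as the root test needs, while t r = sqrt r is
    still below 1.\<close>
  define t where "t = 1 / sqrt r"
  have t: "1 < t"
    using r by (simp add: t_def)
  have tr: "t * r = sqrt r"
    using r by (simp add: t_def real_div_sqrt)
  have "summable (\<lambda>k. t * (real k * sqrt r ^ (k - 1)))"
  proof -
    have "summable (\<lambda>n. diffs (\<lambda>_. 1) n * sqrt r ^ n)"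
      by (rule termdiff_converges[of _ 1]) (use r in \<open>auto simp: summable_geometric\<close>)
    then have "summable (\<lambda>n. real (Suc n) * sqrt r ^ n)"
      by (simp add: diffs_def)
    then have "summable (\<lambda>k. real k * sqrt r ^ (k - 1))"
      by (subst summable_Suc_iff[symmetric]) simp
    then show ?thesis
      by (rule summable_mult)
  qed
  then show ?thesis
  proof (rule summable_comparison_test_ev[rotated])
    show "\<forall>\<^sub>F k in sequentially. norm (L2_set (\<lambda>\<alpha>. cmod (a \<alpha>)) {\<alpha>. length \<alpha> = k} * (real k * r ^ (k - 1)))
        \<le> t * (real k * sqrt r ^ (k - 1))"
      using sqrt_level_le[OF assms(1) t] eventually_gt_at_top[of 0]
    proof eventually_elim
      case (elim k)
      have "L2_set (\<lambda>\<alpha>. cmod (a \<alpha>)) {\<alpha>. length \<alpha> = k} * (real k * r ^ (k - 1)) \<le> t ^ k * (real k * r ^ (k - 1))"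
        using elim r by (intro mult_right_mono) auto
      also have "t ^ k = t * t ^ (k - 1)"
        using elim by (simp flip: power_Suc)
      also have "t * t ^ (k - 1) * (real k * r ^ (k - 1)) = t * (real k * (t * r) ^ (k - 1))"
        by (simp add: power_mult_distrib)
      finally show ?case
        using r by (simp add: tr)
    qed
  qed
qed

text \<open>On a ball of radius r strictly between |z| and 1, Cauchy-Schwarz bounds the derivative
  of level k by the coefficient norm times k r^(k-1), which is summable. The differentiated series
  therefore converges uniformly, and complex homogeneity passes to the sum.\<close>

lemma holomorphic_of_coeffs:
  fixes a :: "'n::finite list \<Rightarrow> complex"
  assumes "limsup (\<lambda>k. ereal (root (2 * k) (\<Sum>\<alpha> | length \<alpha> = k. (cmod (a \<alpha>))\<^sup>2))) \<le> 1"
    and g: "\<And>z. norm z < 1 \<Longrightarrow> (\<lambda>k. \<Sum>\<alpha> | length \<alpha> = k. a \<alpha> * word_eval z \<alpha>) sums g z"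
    and z: "norm (z :: complex ^ 'n) < 1"
  shows "\<exists>D. (g has_derivative D) (at z) \<and> (\<forall>c v. D (c *s v) = c * D v)"
proof -
  obtain r where r: "norm z < r" "r < 1"
    using z dense by blast
  have r0: "0 < r"
    using r norm_ge_zero[of z] by linarith
  define A where "A k = L2_set (\<lambda>\<alpha>. cmod (a \<alpha>)) {\<alpha>. length \<alpha> = k}" for k
  define p where "p k z = (\<Sum>\<alpha> | length \<alpha> = k. a \<alpha> * word_eval z \<alpha>)" for k and z :: "complex ^ 'n"
  define p' where "p' k z v = (\<Sum>\<alpha> | length \<alpha> = k. a \<alpha> * word_deriv z v \<alpha>)" for k and z v :: "complex ^ 'n"
  have A0: "0 \<le> A k" for k
    by (simp add: A_def)
  have summ: "summable (\<lambda>k. A k * (real k * r ^ (k - 1)))"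
    using summable_level[OF assms(1) r0 r(2)] by (simp add: A_def)
  have bound: "norm (p' k z v) \<le> A k * (real k * r ^ (k - 1)) * norm v" if "z \<in> ball 0 r" for k z v
  proof -
    have "norm (p' k z v) \<le> A k * L2_set (\<lambda>\<alpha>. cmod (word_deriv z v \<alpha>)) {\<alpha>. length \<alpha> = k}"
      unfolding p'_def A_def by (rule norm_sum_mult_le_L2)
    also have "\<dots> \<le> A k * (k * norm z ^ (k - 1) * norm v)"
      by (intro mult_left_mono L2_word_deriv A0)
    also have "\<dots> \<le> A k * (k * r ^ (k - 1) * norm v)"
      using that by (intro mult_left_mono mult_right_mono power_mono A0) auto
    finally show ?thesis
      by (simp add: mult_ac)
  qed
  have summ_p': "summable (\<lambda>k. p' k z v)" if "z \<in> ball 0 r" for z v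
    by (rule summable_comparison_test[OF _ summable_mult2[OF summ, of "norm v"]])
      (use bound[OF that] in blast)
  have "\<exists>G. \<forall>x\<in>ball 0 r. (\<lambda>k. p k x) sums G x \<and>
      (G has_derivative (\<lambda>v. \<Sum>k. p' k x v)) (at x within ball 0 r)"
  proof (rule has_derivative_series)
    show "(p k has_derivative p' k x) (at x within ball 0 r)" for k x
      unfolding p_def p'_def
      by (intro has_derivative_sum has_derivative_mult_right has_derivative_word_eval)
    show "\<forall>\<^sub>F n in sequentially. \<forall>x\<in>ball 0 r. \<forall>h. norm ((\<Sum>i<n. p' i x h) - (\<Sum>k. p' k x h)) \<le> e * norm h"
      if "0 < e" for e
    proof -
      obtain N where N: "\<And>n. n \<ge> N \<Longrightarrow> norm (\<Sum>i. A (i + n) * (real (i + n) * r ^ (i + n - 1))) < e"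
        using suminf_exist_split[OF \<open>0 < e\<close> summ] by blast
      have "norm ((\<Sum>i<n. p' i x h) - (\<Sum>k. p' k x h)) \<le> e * norm h"
        if n: "n \<ge> N" and x: "x \<in> ball 0 r" for n x h
      proof -
        have sn: "summable (\<lambda>k. A (k + n) * (real (k + n) * r ^ (k + n - 1)))"
          using summ by (subst summable_iff_shift)
        have "(\<Sum>k. p' k x h) - (\<Sum>i<n. p' i x h) = (\<Sum>k. p' (k + n) x h)"
          by (rule suminf_minus_initial_segment[symmetric]) (rule summ_p'[OF x])
        then have "norm ((\<Sum>i<n. p' i x h) - (\<Sum>k. p' k x h)) = norm (\<Sum>k. p' (k + n) x h)"
          by (metis norm_minus_commute)
        also have "\<dots> \<le> (\<Sum>k. A (k + n) * (real (k + n) * r ^ (k + n - 1)) * norm h)"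
          by (rule norm_suminf_le[OF bound[OF x] summable_mult2[OF sn]])
        also have "\<dots> = (\<Sum>k. A (k + n) * (real (k + n) * r ^ (k + n - 1))) * norm h"
          by (rule suminf_mult2[OF sn, symmetric])
        also have "\<dots> \<le> e * norm h"
          using N[OF n] by (intro mult_right_mono) auto
        finally show ?thesis .
      qed
      then show ?thesis
        unfolding eventually_sequentially by blast
    qed
    show "(\<lambda>k. p k 0) sums g 0"
      using g[of 0] by (simp add: p_def)
  qed (use r0 in auto)
  then obtain G where G: "\<And>x. x \<in> ball 0 r \<Longrightarrow> (\<lambda>k. p k x) sums G x"
    "\<And>x. x \<in> ball 0 r \<Longrightarrow> (G has_derivative (\<lambda>v. \<Sum>k. p' k x v)) (at x within ball 0 r)"
    by blast
  have zr: "z \<in> ball 0 r"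
    using r by simp
  \<comment> \<open>\<open>has_derivative_series\<close> provides some limit function
    \<open>G\<close>; uniqueness of sums identifies it with \<open>g\<close>.\<close>
  have eq: "G x = g x" if "x \<in> ball 0 r" for x
    using G(1)[OF that] g[of x] that r(2) by (auto simp: p_def intro: sums_unique2)
  have "(G has_derivative (\<lambda>v. \<Sum>k. p' k z v)) (at z)"
    using G(2)[OF zr] at_within_open[OF zr open_ball] by simp
  then have "(g has_derivative (\<lambda>v. \<Sum>k. p' k z v)) (at z)"
    by (rule has_derivative_transform_within_open[OF _ open_ball zr eq])
  moreover have "(\<Sum>k. p' k z (c *s v)) = c * (\<Sum>k. p' k z v)" for c v
  proof -
    have "p' k z (c *s v) = c * p' k z v" for k
      by (simp add: p'_def word_deriv_scale sum_distrib_left mult_ac)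
    then show ?thesis
      using suminf_mult[OF summ_p'[OF zr]] by simp
  qed
  ultimately show ?thesis
    by blast
qed

section \<open>The Hardy space\<close>

lemma scalar_op_diff: "scalar_op (c - d) = scalar_op c - scalar_op d"
  by (simp add: eq_diff_eq flip: scalar_op_add)

lemma scalar_op_1_compose [simp]: "scalar_op 1 o\<^sub>L (T :: 'a::complex_hilbert \<Rightarrow>\<^sub>L 'a) = T"
  by (rule blinfun_eqI) (simp add: scalar_op_1)

lemma scalar_op_uminus_compose [simp]:
  "scalar_op (- c) o\<^sub>L T = - (scalar_op c o\<^sub>L (T :: 'a::complex_hilbert \<Rightarrow>\<^sub>L 'a))"
proof -
  have "scalar_op (- c) = - (scalar_op c :: 'a \<Rightarrow>\<^sub>L 'a)"
    using scalar_op_diff[of 0 c] by (simp add: scalar_op_0)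
  then show ?thesis
    by (intro blinfun_eqI) (simp add: blinfun.minus_left flip: scalar_op_apply)
qed

lemma has_derivative_vecI:
  fixes f :: "'a::real_normed_vector \<Rightarrow> complex ^ 'n"
  assumes "\<And>i. ((\<lambda>x. f x $ i) has_derivative D i) (at z within S)"
  shows "(f has_derivative (\<lambda>v. \<chi> i. D i v)) (at z within S)"
  by (rule has_derivative_componentwise_within[THEN iffD2])
    (auto simp: Basis_vec_def inner_axis intro: has_derivative_inner_left assms)

lemma cmod_word_eval_le:
  assumes "norm (z :: complex ^ 'n) \<le> 1"
  shows "cmod (word_eval z \<alpha>) \<le> 1"
proof (induction \<alpha>)
  case (Cons i \<alpha>)
  have "cmod (z $ i) \<le> 1"
    using Finite_Cartesian_Product.norm_nth_le[of z i] assms by linarith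
  then show ?case
    using Cons by (simp add: norm_mult mult_le_one)
qed simp

text \<open>The levels contribute a geometric series in |z|^2, whose full sum is the squared norm of
  the Szegoe kernel at z.\<close>

lemma L2_word_eval_less:
  assumes "norm (z :: complex ^ 'n) < 1"
  shows "L2_set (\<lambda>\<alpha>. cmod (word_eval z \<alpha>)) {\<alpha>. length \<alpha> < m} \<le> 1 / sqrt (1 - (norm z)\<^sup>2)"
proof -
  have lt: "(norm z)\<^sup>2 < 1"
    using assms by (simp add: abs_square_less_1)
  have "(\<Sum>\<alpha> | length \<alpha> < m. (cmod (word_eval z \<alpha>))\<^sup>2) = (\<Sum>k<m. ((norm z)\<^sup>2) ^ k)"
    by (simp add: sum_words_less sum_word_eval_sq power_mult)
  also have "\<dots> \<le> (\<Sum>k. ((norm z)\<^sup>2) ^ k)"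
    using lt by (intro sum_le_suminf summable_geometric) auto
  also have "\<dots> = 1 / (1 - (norm z)\<^sup>2)"
    using lt by (subst suminf_geometric) auto
  finally have "sqrt (\<Sum>\<alpha> | length \<alpha> < m. (cmod (word_eval z \<alpha>))\<^sup>2) \<le> sqrt (1 / (1 - (norm z)\<^sup>2))"
    by (rule real_sqrt_le_mono)
  then show ?thesis
    by (simp add: L2_set_def real_sqrt_divide)
qed

section \<open>Square summable coefficient families\<close>

abbreviation sq_summable :: "('a \<Rightarrow> complex) \<Rightarrow> bool" where
  "sq_summable a \<equiv> (\<lambda>\<alpha>. (cmod (a \<alpha>))\<^sup>2) summable_on UNIV"

definition l2_norm :: "('a \<Rightarrow> complex) \<Rightarrow> real" where
  "l2_norm a = sqrt (\<Sum>\<^sub>\<infinity>\<alpha>. (cmod (a \<alpha>))\<^sup>2)"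

lemma l2_norm_nonneg [simp]: "0 \<le> l2_norm a"
  by (simp add: l2_norm_def infsum_nonneg)

lemma L2_set_le_l2_norm:
  assumes "sq_summable a" "finite F"
  shows "L2_set (\<lambda>\<alpha>. cmod (a \<alpha>)) F \<le> l2_norm a"
  unfolding L2_set_def l2_norm_def
  by (intro real_sqrt_le_mono finite_sum_le_infsum assms) auto

text \<open>Summability and the norm bound both follow from finite sections, so the triangle
  inequality is inherited from \<open>L2_set\<close>.\<close>

lemma l2_norm_boundI:
  assumes "\<And>F. finite F \<Longrightarrow> L2_set (\<lambda>\<alpha>. cmod (a \<alpha>)) F \<le> C"
  shows "sq_summable a" "l2_norm a \<le> C"
proof -
  have C: "0 \<le> C"
    using assms[of "{}"] by simp
  have le: "(\<Sum>\<alpha>\<in>F. (cmod (a \<alpha>))\<^sup>2) \<le> C\<^sup>2" if "finite F" for F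
    using assms[OF that] by (simp add: L2_set_def real_le_lsqrt sqrt_le_D)
  then show s: "sq_summable a"
    by (intro nonneg_bdd_above_summable_on bdd_aboveI[of _ "C\<^sup>2"]) auto
  have "(\<Sum>\<^sub>\<infinity>\<alpha>. (cmod (a \<alpha>))\<^sup>2) \<le> C\<^sup>2"
    by (rule infsum_le_finite_sums[OF s]) (use le in auto)
  then show "l2_norm a \<le> C"
    unfolding l2_norm_def using C by (intro real_le_lsqrt) (auto intro: infsum_nonneg)
qed

lemma l2_norm_add:
  assumes "sq_summable a" "sq_summable b"
  shows "sq_summable (\<lambda>\<alpha>. a \<alpha> + b \<alpha>)" "l2_norm (\<lambda>\<alpha>. a \<alpha> + b \<alpha>) \<le> l2_norm a + l2_norm b"
proof -
  have "L2_set (\<lambda>\<alpha>. cmod (a \<alpha> + b \<alpha>)) F \<le> l2_norm a + l2_norm b" if "finite F" for F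
  proof -
    have "L2_set (\<lambda>\<alpha>. cmod (a \<alpha> + b \<alpha>)) F \<le> L2_set (\<lambda>\<alpha>. cmod (a \<alpha>) + cmod (b \<alpha>)) F"
      by (intro L2_set_mono norm_triangle_ineq) auto
    also have "\<dots> \<le> L2_set (\<lambda>\<alpha>. cmod (a \<alpha>)) F + L2_set (\<lambda>\<alpha>. cmod (b \<alpha>)) F"
      by (rule L2_set_triangle_ineq)
    also have "\<dots> \<le> l2_norm a + l2_norm b"
      by (intro add_mono L2_set_le_l2_norm assms that)
    finally show ?thesis .
  qed
  from l2_norm_boundI[OF this] show "sq_summable (\<lambda>\<alpha>. a \<alpha> + b \<alpha>)"
    "l2_norm (\<lambda>\<alpha>. a \<alpha> + b \<alpha>) \<le> l2_norm a + l2_norm b"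
    by blast+
qed

lemma sq_summable_diff:
  assumes "sq_summable a" "sq_summable b"
  shows "sq_summable (\<lambda>\<alpha>. a \<alpha> - b \<alpha>)"
  using l2_norm_add(1)[of a "\<lambda>\<alpha>. - b \<alpha>"] assms by simp

lemma l2_norm_eq_0_iff:
  assumes "sq_summable a"
  shows "l2_norm a = 0 \<longleftrightarrow> (\<forall>\<alpha>. a \<alpha> = 0)"
proof
  assume "l2_norm a = 0"
  then have "L2_set (\<lambda>\<alpha>. cmod (a \<alpha>)) {\<beta>} \<le> 0" for \<beta>
    using L2_set_le_l2_norm[OF assms, of "{\<beta>}"] by simp
  then show "\<forall>\<alpha>. a \<alpha> = 0"
    by simp
qed (simp add: l2_norm_def)

text \<open>Each level is bounded by the total sum, and the roots of a positive constant tend to 1.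
  Hence square summability supplies the growth clause of \<open>has_free_expansion\<close>.\<close>

lemma limsup_level_of_sq_summable:
  fixes a :: "'n::finite list \<Rightarrow> complex"
  assumes "sq_summable a"
  shows "limsup (\<lambda>k. ereal (root (2 * k) (\<Sum>\<alpha> | length \<alpha> = k. (cmod (a \<alpha>))\<^sup>2))) \<le> 1"
proof -
  \<comment> \<open>The summand 1 keeps C positive even for the zero family, as needed for its roots
    to tend to 1.\<close>
  define C where "C = 1 + (\<Sum>\<^sub>\<infinity>\<alpha>. (cmod (a \<alpha>))\<^sup>2)"
  have "0 \<le> (\<Sum>\<^sub>\<infinity>\<alpha>. (cmod (a \<alpha>))\<^sup>2)"
    by (rule infsum_nonneg) auto
  then have C: "C > 0"
    by (simp add: C_def)
  have "(\<lambda>k. root (2 * k) C) \<longlonglongrightarrow> 1"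
    using LIMSEQ_subseq_LIMSEQ[OF LIMSEQ_root_const[OF C], of "\<lambda>k. 2 * k"]
    by (simp add: o_def strict_mono_def)
  then have lim: "limsup (\<lambda>k. ereal (root (2 * k) C)) = 1"
    by (intro lim_imp_Limsup) (auto simp: one_ereal_def)
  have "root (2 * k) (\<Sum>\<alpha> | length \<alpha> = k. (cmod (a \<alpha>))\<^sup>2) \<le> root (2 * k) C" if "k > 0" for k
  proof -
    have "(\<Sum>\<alpha> | length \<alpha> = k. (cmod (a \<alpha>))\<^sup>2) \<le> (\<Sum>\<^sub>\<infinity>\<alpha>. (cmod (a \<alpha>))\<^sup>2)"
      by (intro finite_sum_le_infsum assms) auto
    then show ?thesis
      using that by (simp add: C_def)
  qed
  then have "limsup (\<lambda>k. ereal (root (2 * k) (\<Sum>\<alpha> | length \<alpha> = k. (cmod (a \<alpha>))\<^sup>2)))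
      \<le> limsup (\<lambda>k. ereal (root (2 * k) C))"
    by (intro Limsup_mono eventually_mono[OF eventually_gt_at_top[of 0]]) auto
  then show ?thesis
    by (simp add: lim)
qed

locale infinite_dimensional =
  fixes hilbert_type :: "'h::complex_hilbert itself"
  assumes not_finitely_spanned: "\<not> (\<exists>B :: 'h set. finite B \<and> module.span (*\<^sub>C) B = UNIV)"
begin

lemma nonzero_vector:
  obtains x :: 'h where "x \<noteq> 0"
proof -
  interpret V: vector_space "(*\<^sub>C) :: complex \<Rightarrow> 'h \<Rightarrow> 'h"
    by (rule vector_space_scaleC)
  have "V.span {} \<noteq> UNIV"
    using not_finitely_spanned by blast
  then show ?thesis
    using that by auto
qed

lemma norm_scalar_op [simp]: "norm (scalar_op c :: 'h \<Rightarrow>\<^sub>L 'h) = cmod c"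
  using nonzero_vector norm_scalar_op by metis

lemma scalar_op_tendsto_iff:
  "((\<lambda>k. scalar_op (s k) :: 'h \<Rightarrow>\<^sub>L 'h) \<longlongrightarrow> scalar_op l) F \<longleftrightarrow> (s \<longlongrightarrow> l) F"
  by (simp add: tendsto_iff dist_norm flip: scalar_op_diff)

lemma scalar_op_sums_iff:
  "(\<lambda>k. scalar_op (s k) :: 'h \<Rightarrow>\<^sub>L 'h) sums scalar_op l \<longleftrightarrow> s sums l"
  by (simp add: sums_def scalar_op_sum scalar_op_tendsto_iff)

lemma has_free_expansion_scalar:
  fixes f :: "('h \<Rightarrow>\<^sub>L 'h) ^ 'n \<Rightarrow> 'h \<Rightarrow>\<^sub>L 'h"
  assumes "has_free_expansion f a" "norm z < 1"
  shows "(\<lambda>k. scalar_op (\<Sum>\<alpha> | length \<alpha> = k. a \<alpha> * word_eval z \<alpha>)) sums f (scalar_tuple z)"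
proof -
  have "(\<lambda>k. \<Sum>\<alpha> | length \<alpha> = k. scalar_op (a \<alpha>) o\<^sub>L word_op (scalar_tuple z) \<alpha>) sums f (scalar_tuple z)"
    using assms scalar_tuple_in_nc_ball by (auto simp: has_free_expansion_def)
  then show ?thesis
    by (simp add: word_op_scalar_tuple_eq scalar_op_mult scalar_op_sum)
qed

context
  fixes \<phi> :: "('h \<Rightarrow>\<^sub>L 'h) ^ 'n \<Rightarrow> ('h \<Rightarrow>\<^sub>L 'h) ^ 'n"
  assumes self_map: "free_holomorphic_self_map \<phi>"
begin

lemma apply_scalar_tuple:
  "norm z < 1 \<Longrightarrow> \<phi> (scalar_tuple z) = scalar_tuple (scalar_rep \<phi> z)"
  using nonzero_vector scalar_rep_eq[OF self_map] by metis

lemma norm_scalar_rep_less: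
  assumes "norm z < 1"
  shows "norm (scalar_rep \<phi> z) < 1"
proof -
  have "(scalar_tuple (scalar_rep \<phi> z) :: ('h \<Rightarrow>\<^sub>L 'h) ^ 'n) \<in> nc_ball"
    using self_map scalar_tuple_in_nc_ball[OF assms] apply_scalar_tuple[OF assms]
    unfolding free_holomorphic_self_map_def by (metis image_subset_iff)
  then have "(norm (scalar_rep \<phi> z))\<^sup>2 < 1"
    by (simp add: nc_ball_def row_scalar_tuple del: of_real_power)
  then show ?thesis
    by (simp add: abs_square_less_1)
qed

lemma holomorphic_scalar_rep: "holomorphic_map_on (scalar_rep \<phi>) (ball 0 1)"
  unfolding holomorphic_map_on_def
proof
  fix z :: "complex ^ 'n" assume z: "z \<in> ball 0 1"
  have "\<exists>D. ((\<lambda>z. scalar_rep \<phi> z $ i) has_derivative D) (at z) \<and> (\<forall>c v. D (c *s v) = c * D v)" for i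
  proof -
    obtain a where a: "has_free_expansion (\<lambda>X. \<phi> X $ i) a"
      using self_map unfolding free_holomorphic_self_map_def free_holomorphic_def by blast
    show ?thesis
    proof (rule holomorphic_of_coeffs)
      show "limsup (\<lambda>k. ereal (root (2 * k) (\<Sum>\<alpha> | length \<alpha> = k. (cmod (a \<alpha>))\<^sup>2))) \<le> 1"
        using a by (simp add: has_free_expansion_def)
      show "(\<lambda>k. \<Sum>\<alpha> | length \<alpha> = k. a \<alpha> * word_eval w \<alpha>) sums (scalar_rep \<phi> w $ i)"
        if "norm w < 1" for w
        using has_free_expansion_scalar[OF a that]
        unfolding apply_scalar_tuple[OF that]
        by (simp add: scalar_tuple_def[of "scalar_rep _ _"] scalar_op_sums_iff)
    qed (use z in simp)
  qed
  then obtain D where D: "\<And>i. ((\<lambda>z. scalar_rep \<phi> z $ i) has_derivative D i) (at z)"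
    "\<And>i c v. D i (c *s v) = c * D i v"
    by metis
  then show "\<exists>D. (scalar_rep \<phi> has_derivative D) (at z) \<and> (\<forall>c v. D (c *s v) = c *s D v)"
    by (intro exI[of _ "\<lambda>v. \<chi> i. D i v"]) (auto intro!: has_derivative_vecI simp: vec_eq_iff)
qed

end

section \<open>The Hardy space as a metric space\<close>

lemma H2_ballD:
  fixes f :: "('h \<Rightarrow>\<^sub>L 'h) ^ 'n \<Rightarrow> 'h \<Rightarrow>\<^sub>L 'h"
  assumes "f \<in> H2_ball"
  shows "f \<in> extensional nc_ball" "has_free_expansion f (free_coeff f)" "sq_summable (free_coeff f)"
proof -
  show "f \<in> extensional nc_ball" "sq_summable (free_coeff f)"
    using assms by (auto simp: H2_ball_def)
  obtain a where "has_free_expansion f a"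
    using assms by (auto simp: H2_ball_def free_holomorphic_def)
  then show "has_free_expansion f (free_coeff f)"
    using free_coeff_eq[OF not_finitely_spanned] by metis
qed

lemma H2_ballI:
  fixes f :: "('h \<Rightarrow>\<^sub>L 'h) ^ 'n \<Rightarrow> 'h \<Rightarrow>\<^sub>L 'h"
  assumes "f \<in> extensional nc_ball" "has_free_expansion f a" "sq_summable a"
  shows "f \<in> H2_ball"
  using assms free_coeff_eq[OF not_finitely_spanned assms(2)]
  by (auto simp: H2_ball_def free_holomorphic_def)

lemma H2_norm_eq: "H2_norm f = l2_norm (free_coeff f)"
  by (simp add: H2_norm_def l2_norm_def)

abbreviation H2_diff where "H2_diff f g \<equiv> H2_lincomb 1 f (-1) g"

lemma has_free_expansion_diff:
  fixes f g :: "('h \<Rightarrow>\<^sub>L 'h) ^ 'n \<Rightarrow> 'h \<Rightarrow>\<^sub>L 'h"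
  assumes f: "f \<in> H2_ball" and g: "g \<in> H2_ball"
  shows "has_free_expansion (H2_diff f g) (\<lambda>\<alpha>. free_coeff f \<alpha> - free_coeff g \<alpha>)"
  unfolding has_free_expansion_def
proof (intro conjI ballI)
  show "limsup (\<lambda>k. ereal (root (2 * k) (\<Sum>\<alpha> | length \<alpha> = k. (cmod (free_coeff f \<alpha> - free_coeff g \<alpha>))\<^sup>2))) \<le> 1"
    by (intro limsup_level_of_sq_summable sq_summable_diff H2_ballD assms)
  fix X :: "('h \<Rightarrow>\<^sub>L 'h) ^ 'n" assume X: "X \<in> nc_ball"
  have "(\<lambda>k. (\<Sum>\<alpha> | length \<alpha> = k. scalar_op (free_coeff f \<alpha>) o\<^sub>L word_op X \<alpha>) -
      (\<Sum>\<alpha> | length \<alpha> = k. scalar_op (free_coeff g \<alpha>) o\<^sub>L word_op X \<alpha>)) sums (f X - g X)"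
    using H2_ballD(2)[OF f] H2_ballD(2)[OF g] X
    by (intro sums_diff) (auto simp: has_free_expansion_def)
  moreover have "scalar_op (c - d) o\<^sub>L T = (scalar_op c o\<^sub>L T) - (scalar_op d o\<^sub>L T)" for c d and T :: "'h \<Rightarrow>\<^sub>L 'h"
    by (rule blinfun_eqI) (simp add: scalar_op_diff blinfun.diff_left flip: scalar_op_apply)
  ultimately show "(\<lambda>k. \<Sum>\<alpha> | length \<alpha> = k. scalar_op (free_coeff f \<alpha> - free_coeff g \<alpha>) o\<^sub>L word_op X \<alpha>)
      sums H2_diff f g X"
    using X by (simp add: H2_lincomb_def sum_subtractf)
qed

lemma free_coeff_diff:
  fixes f g :: "('h \<Rightarrow>\<^sub>L 'h) ^ 'n \<Rightarrow> 'h \<Rightarrow>\<^sub>L 'h"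
  assumes "f \<in> H2_ball" "g \<in> H2_ball"
  shows "free_coeff (H2_diff f g) = (\<lambda>\<alpha>. free_coeff f \<alpha> - free_coeff g \<alpha>)"
  by (rule free_coeff_eq[OF not_finitely_spanned has_free_expansion_diff[OF assms]])

lemma H2_diff_in_H2:
  fixes f g :: "('h \<Rightarrow>\<^sub>L 'h) ^ 'n \<Rightarrow> 'h \<Rightarrow>\<^sub>L 'h"
  assumes "f \<in> H2_ball" "g \<in> H2_ball"
  shows "H2_diff f g \<in> H2_ball"
  by (rule H2_ballI[OF _ has_free_expansion_diff[OF assms]])
    (auto simp: H2_lincomb_def intro: sq_summable_diff H2_ballD assms)

text \<open>The locale of metric spaces demands symmetry outside of the carrier as well, where
  \<^const>\<open>free_coeff\<close> is an unspecified value.\<close>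

lemma H2_dist_commute:
  fixes f g :: "('h \<Rightarrow>\<^sub>L 'h) ^ 'n \<Rightarrow> 'h \<Rightarrow>\<^sub>L 'h"
  shows "H2_norm (H2_diff f g) = H2_norm (H2_diff g f)"
proof -
  have *: "has_free_expansion (H2_diff q p) (\<lambda>\<alpha>. - a \<alpha>)" if "has_free_expansion (H2_diff p q) a"
    for a and p q :: "('h \<Rightarrow>\<^sub>L 'h) ^ 'n \<Rightarrow> 'h \<Rightarrow>\<^sub>L 'h"
    unfolding has_free_expansion_def
  proof (intro conjI ballI)
    fix X :: "('h \<Rightarrow>\<^sub>L 'h) ^ 'n" assume X: "X \<in> nc_ball"
    have "(\<lambda>k. - (\<Sum>\<alpha> | length \<alpha> = k. scalar_op (a \<alpha>) o\<^sub>L word_op X \<alpha>)) sums - H2_diff p q X"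
      using that X by (intro sums_minus) (auto simp: has_free_expansion_def)
    then show "(\<lambda>k. \<Sum>\<alpha> | length \<alpha> = k. scalar_op (- a \<alpha>) o\<^sub>L word_op X \<alpha>) sums H2_diff q p X"
      using X by (simp add: H2_lincomb_def scalar_op_uminus_compose sum_negf)
  qed (use that in \<open>simp add: has_free_expansion_def\<close>)
  show ?thesis
  proof (cases "\<exists>a. has_free_expansion (H2_diff f g) a")
    case True
    then obtain a where a: "has_free_expansion (H2_diff f g) a"
      by blast
    show ?thesis
      using free_coeff_eq[OF not_finitely_spanned a] free_coeff_eq[OF not_finitely_spanned *[OF a]]
      by (simp add: H2_norm_def)
  next
    case False
    \<comment> \<open>Neither difference has an expansion, so both descriptions in
      \<open>free_coeff\<close> concern the same empty predicate and denote the same value.\<close>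
    with * have "\<not> has_free_expansion (H2_diff f g) a" "\<not> has_free_expansion (H2_diff g f) a" for a
      by blast+
    then show ?thesis
      by (simp add: H2_norm_def free_coeff_def)
  qed
qed

lemma Metric_space_H2:
  "Metric_space (H2_ball :: (('h \<Rightarrow>\<^sub>L 'h) ^ 'n \<Rightarrow> 'h \<Rightarrow>\<^sub>L 'h) set) (\<lambda>f g. H2_norm (H2_diff f g))"
proof
  fix f g h :: "('h \<Rightarrow>\<^sub>L 'h) ^ 'n \<Rightarrow> 'h \<Rightarrow>\<^sub>L 'h"
  show "0 \<le> H2_norm (H2_diff f g)"
    by (simp add: H2_norm_eq)
  show "H2_norm (H2_diff f g) = H2_norm (H2_diff g f)"
    by (rule H2_dist_commute)
  assume f: "f \<in> H2_ball" and g: "g \<in> H2_ball"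
  show "H2_norm (H2_diff f g) = 0 \<longleftrightarrow> f = g"
  proof
    assume "H2_norm (H2_diff f g) = 0"
    then have "free_coeff f = free_coeff g"
      using l2_norm_eq_0_iff[OF sq_summable_diff[OF H2_ballD(3)[OF f] H2_ballD(3)[OF g]]]
      by (auto simp: H2_norm_eq free_coeff_diff f g)
    \<comment> \<open>Coefficients determine the values on \<open>nc_ball\<close> only; membership
      in \<open>extensional\<close> settles the rest.\<close>
    show "f = g"
    proof (rule extensionalityI[OF H2_ballD(1)[OF f] H2_ballD(1)[OF g]])
      fix X :: "('h \<Rightarrow>\<^sub>L 'h) ^ 'n" assume X: "X \<in> nc_ball"
      let ?p = "\<lambda>k. \<Sum>\<alpha> | length \<alpha> = k. scalar_op (free_coeff f \<alpha>) o\<^sub>L word_op X \<alpha>"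
      have "?p sums f X"
        using H2_ballD(2)[OF f] X by (simp add: has_free_expansion_def)
      moreover have "?p sums g X"
        using H2_ballD(2)[OF g] X by (simp add: has_free_expansion_def \<open>free_coeff f = free_coeff g\<close>)
      ultimately show "f X = g X"
        by (rule sums_unique2)
    qed
  qed (simp add: H2_norm_eq free_coeff_diff f g l2_norm_def)
  assume h: "h \<in> H2_ball"
  show "H2_norm (H2_diff f h) \<le> H2_norm (H2_diff f g) + H2_norm (H2_diff g h)"
    using l2_norm_add(2)[OF sq_summable_diff[OF H2_ballD(3)[OF f] H2_ballD(3)[OF g]]
        sq_summable_diff[OF H2_ballD(3)[OF g] H2_ballD(3)[OF h]]]
    by (simp add: H2_norm_eq free_coeff_diff f g h)
qed

section \<open>Point evaluations and the boundary consequence of compactness\<close>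

text \<open>Coefficients in F are summed crudely, since monomials are bounded by 1 on the ball; the
  others are paired with the kernel by Cauchy-Schwarz. Empty F gives the usual evaluation bound,
  while large F makes the factor of the kernel norm as small as desired.\<close>

lemma norm_H2_eval_le:
  fixes f :: "('h \<Rightarrow>\<^sub>L 'h) ^ 'n \<Rightarrow> 'h \<Rightarrow>\<^sub>L 'h"
  assumes f: "f \<in> H2_ball" and z: "norm z < 1" and F: "finite F"
  shows "norm (f (scalar_tuple z)) \<le> (\<Sum>\<alpha>\<in>F. cmod (free_coeff f \<alpha>)) +
    sqrt (\<Sum>\<^sub>\<infinity>\<alpha>\<in>-F. (cmod (free_coeff f \<alpha>))\<^sup>2) / sqrt (1 - (norm z)\<^sup>2)"
    (is "_ \<le> ?R")
proof -
  let ?c = "free_coeff f"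
  let ?W = "\<lambda>m. {\<alpha> :: 'n list. length \<alpha> < m}"
  have lt: "(norm z)\<^sup>2 < 1"
    using z by (simp add: abs_square_less_1)
  have "(\<lambda>k. scalar_op (\<Sum>\<alpha> | length \<alpha> = k. ?c \<alpha> * word_eval z \<alpha>)) sums f (scalar_tuple z)"
    by (rule has_free_expansion_scalar[OF H2_ballD(2)[OF f] z])
  then have "(\<lambda>m. scalar_op (\<Sum>\<alpha>\<in>?W m. ?c \<alpha> * word_eval z \<alpha>)) \<longlonglongrightarrow> f (scalar_tuple z)"
    by (simp add: sums_def scalar_op_sum sum_words_less)
  then have "(\<lambda>m. norm (scalar_op (\<Sum>\<alpha>\<in>?W m. ?c \<alpha> * word_eval z \<alpha>) :: 'h \<Rightarrow>\<^sub>L 'h)) \<longlonglongrightarrow> norm (f (scalar_tuple z))"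
    by (rule tendsto_norm)
  moreover have "norm (scalar_op (\<Sum>\<alpha>\<in>?W m. ?c \<alpha> * word_eval z \<alpha>) :: 'h \<Rightarrow>\<^sub>L 'h) \<le> ?R" for m
  proof -
    have "(\<Sum>\<alpha>\<in>?W m. ?c \<alpha> * word_eval z \<alpha>) =
        (\<Sum>\<alpha>\<in>?W m \<inter> F. ?c \<alpha> * word_eval z \<alpha>) + (\<Sum>\<alpha>\<in>?W m - F. ?c \<alpha> * word_eval z \<alpha>)"
      by (rule sum.Int_Diff) simp
    then have "norm (scalar_op (\<Sum>\<alpha>\<in>?W m. ?c \<alpha> * word_eval z \<alpha>) :: 'h \<Rightarrow>\<^sub>L 'h) \<le>
        cmod (\<Sum>\<alpha>\<in>?W m \<inter> F. ?c \<alpha> * word_eval z \<alpha>) + cmod (\<Sum>\<alpha>\<in>?W m - F. ?c \<alpha> * word_eval z \<alpha>)"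
      by (simp add: norm_triangle_ineq)
    also have "cmod (\<Sum>\<alpha>\<in>?W m \<inter> F. ?c \<alpha> * word_eval z \<alpha>) \<le> (\<Sum>\<alpha>\<in>?W m \<inter> F. cmod (?c \<alpha>))"
      using z by (intro sum_norm_le) (simp add: norm_mult mult_left_le cmod_word_eval_le)
    also have "\<dots> \<le> (\<Sum>\<alpha>\<in>F. cmod (?c \<alpha>))"
      by (intro sum_mono2) (use F in auto)
    also have "cmod (\<Sum>\<alpha>\<in>?W m - F. ?c \<alpha> * word_eval z \<alpha>) \<le>
        L2_set (\<lambda>\<alpha>. cmod (?c \<alpha>)) (?W m - F) * L2_set (\<lambda>\<alpha>. cmod (word_eval z \<alpha>)) (?W m - F)"
      by (rule norm_sum_mult_le_L2)
    also have "\<dots> \<le> sqrt (\<Sum>\<^sub>\<infinity>\<alpha>\<in>-F. (cmod (?c \<alpha>))\<^sup>2) * (1 / sqrt (1 - (norm z)\<^sup>2))"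
    proof (rule mult_mono)
      show "L2_set (\<lambda>\<alpha>. cmod (?c \<alpha>)) (?W m - F) \<le> sqrt (\<Sum>\<^sub>\<infinity>\<alpha>\<in>-F. (cmod (?c \<alpha>))\<^sup>2)"
        unfolding L2_set_def
        by (intro real_sqrt_le_mono finite_sum_le_infsum summable_on_subset_banach[OF H2_ballD(3)[OF f]]) auto
      have "L2_set (\<lambda>\<alpha>. cmod (word_eval z \<alpha>)) (?W m - F) \<le> L2_set (\<lambda>\<alpha>. cmod (word_eval z \<alpha>)) (?W m)"
        unfolding L2_set_def by (intro real_sqrt_le_mono sum_mono2) auto
      then show "L2_set (\<lambda>\<alpha>. cmod (word_eval z \<alpha>)) (?W m - F) \<le> 1 / sqrt (1 - (norm z)\<^sup>2)"
        using L2_word_eval_less[OF z, of m] by linarith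
    qed (auto intro: infsum_nonneg)
    finally show ?thesis
      by simp
  qed
  ultimately show ?thesis
    by (intro LIMSEQ_le_const2[of _ "norm (f (scalar_tuple z))"]) auto
qed

text \<open>The test function is a truncated normalised kernel: a polynomial lies in the Hardy space
  without any estimate of operator norms of the \<open>X\<^sub>\<alpha>\<close>.\<close>

lemma exists_test_function:
  assumes w: "norm (w :: complex ^ 'n) < 1"
  shows "\<exists>f \<in> H2_ball. H2_norm f \<le> 1 \<and>
    norm (f (scalar_tuple w) :: 'h \<Rightarrow>\<^sub>L 'h) \<ge> 1 / (2 * sqrt (1 - (norm w)\<^sup>2))"
proof -
  define q where "q = 1 / (1 - (norm w)\<^sup>2)"
  have lt: "(norm w)\<^sup>2 < 1"
    using w by (simp add: abs_square_less_1)
  then have q: "q > 0"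
    by (simp add: q_def)
  have "(\<lambda>k. ((norm w)\<^sup>2) ^ k) sums q"
    unfolding q_def using lt by (intro geometric_sums) auto
  then have "(\<lambda>N. \<Sum>k<N. ((norm w)\<^sup>2) ^ k) \<longlonglongrightarrow> q"
    by (simp add: sums_def)
  then have "\<forall>\<^sub>F N in sequentially. (\<Sum>k<N. ((norm w)\<^sup>2) ^ k) > q / 4"
    using q by (intro order_tendstoD) auto
  \<comment> \<open>Here q is the squared kernel norm at w. The fraction 1/4 becomes the 1/2 of the
    claim under the square root.\<close>
  then obtain N where N: "(\<Sum>k<N. ((norm w)\<^sup>2) ^ k) > q / 4"
    using eventually_happens'[OF sequentially_bot] by blast
  define S where "S = (\<Sum>\<alpha> | length \<alpha> < N. (cmod (word_eval w \<alpha>))\<^sup>2)"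
  have S: "S > q / 4"
    using N by (simp add: S_def sum_words_less sum_word_eval_sq power_mult)
  then have S0: "S > 0"
    using q by linarith
  \<comment> \<open>Conjugation makes every term of the value at w nonnegative; dividing by sqrt S
    gives norm 1, so that value is S / sqrt S = sqrt S.\<close>
  define a where "a \<alpha> = (if length \<alpha> < N then cnj (word_eval w \<alpha>) / sqrt S else 0)" for \<alpha>
  define f :: "('h \<Rightarrow>\<^sub>L 'h) ^ 'n \<Rightarrow> 'h \<Rightarrow>\<^sub>L 'h" where
    "f = (\<lambda>X\<in>nc_ball. \<Sum>\<alpha> | length \<alpha> < N. scalar_op (a \<alpha>) o\<^sub>L word_op X \<alpha>)"
  have hs: "((\<lambda>\<alpha>. (cmod (a \<alpha>))\<^sup>2) has_sum 1) UNIV"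
  proof -
    have "((\<lambda>\<alpha>. (cmod (a \<alpha>))\<^sup>2) has_sum (\<Sum>\<alpha> | length \<alpha> < N. (cmod (a \<alpha>))\<^sup>2)) {\<alpha>. length \<alpha> < N}"
      by (rule has_sum_finite) simp
    also have "(\<Sum>\<alpha> | length \<alpha> < N. (cmod (a \<alpha>))\<^sup>2) = (\<Sum>\<alpha> | length \<alpha> < N. (cmod (word_eval w \<alpha>))\<^sup>2 / S)"
      using S0 by (intro sum.cong) (auto simp: a_def norm_divide power_divide)
    also have "\<dots> = 1"
      using S0 by (simp flip: sum_divide_distrib S_def)
    finally show ?thesis
      by (rule has_sum_cong_neutral[THEN iffD1, rotated -1]) (auto simp: a_def)
  qed
  then have sq: "sq_summable a" and l2: "l2_norm a = 1"
    by (auto simp: summable_on_def l2_norm_def infsumI)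
  have exp: "has_free_expansion f a"
    unfolding has_free_expansion_def
  proof (intro conjI ballI limsup_level_of_sq_summable sq)
    fix X :: "('h \<Rightarrow>\<^sub>L 'h) ^ 'n" assume X: "X \<in> nc_ball"
    have "(\<lambda>k. \<Sum>\<alpha> | length \<alpha> = k. scalar_op (a \<alpha>) o\<^sub>L word_op X \<alpha>) sums
        (\<Sum>k<N. \<Sum>\<alpha> | length \<alpha> = k. scalar_op (a \<alpha>) o\<^sub>L word_op X \<alpha>)"
      by (rule sums_finite) (auto simp: a_def scalar_op_0)
    then show "(\<lambda>k. \<Sum>\<alpha> | length \<alpha> = k. scalar_op (a \<alpha>) o\<^sub>L word_op X \<alpha>) sums f X"
      using X by (simp add: f_def sum_words_less)
  qed
  have "f \<in> H2_ball"
    by (rule H2_ballI[OF _ exp sq]) (simp add: f_def)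
  moreover have "H2_norm f = 1"
    using l2 by (simp add: H2_norm_eq free_coeff_eq[OF not_finitely_spanned exp])
  moreover have "norm (f (scalar_tuple w)) = sqrt S"
  proof -
    have "f (scalar_tuple w) = scalar_op (\<Sum>\<alpha> | length \<alpha> < N. a \<alpha> * word_eval w \<alpha>)"
      using scalar_tuple_in_nc_ball[OF w, where 'h = 'h]
      by (simp add: f_def word_op_scalar_tuple_eq scalar_op_mult scalar_op_sum)
    also have "(\<Sum>\<alpha> | length \<alpha> < N. a \<alpha> * word_eval w \<alpha>) = complex_of_real
        (\<Sum>\<alpha> | length \<alpha> < N. (cmod (word_eval w \<alpha>))\<^sup>2 / sqrt S)"
      unfolding of_real_sum of_real_divide complex_norm_square
      by (intro sum.cong) (auto simp: a_def mult.commute)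
    also have "\<dots> = of_real (S / sqrt S)"
      by (simp flip: S_def sum_divide_distrib)
    finally show ?thesis
      using S0 by (simp add: real_div_sqrt del: of_real_divide)
  qed
  moreover have "1 / (2 * sqrt (1 - (norm w)\<^sup>2)) = sqrt (q / 4)"
    unfolding q_def real_sqrt_divide real_sqrt_four by simp
  moreover have "sqrt (q / 4) \<le> sqrt S"
    using S by (intro real_sqrt_le_mono) simp
  ultimately show ?thesis
    by (intro bexI[of _ f]) auto
qed

text \<open>A violating sequence near the sphere yields unit-ball functions whose images are at
  least a fixed multiple of 1 / s k at z k, where s k is the square root of 1 - |z k|^2. A
  subsequence of the images converges in norm, but its limit grows more slowly than that.\<close>

lemma compact_comp_op_defect:
  fixes \<phi> :: "('h \<Rightarrow>\<^sub>L 'h) ^ 'n \<Rightarrow> ('h \<Rightarrow>\<^sub>L 'h) ^ 'n"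
  assumes self_map: "free_holomorphic_self_map \<phi>"
    and compact: "H2_compact_operator (comp_op \<phi>)"
    and \<delta>: "0 < \<delta>"
  shows "\<exists>r<1. \<forall>z. r < norm z \<longrightarrow> norm z < 1 \<longrightarrow>
    1 - (norm z)\<^sup>2 \<le> \<delta> * (1 - (norm (scalar_rep \<phi> z))\<^sup>2)"
proof (rule ccontr)
  let ?\<psi> = "scalar_rep \<phi>"
  assume "\<not> ?thesis"
  then have "\<exists>z. 1 - 1 / real (Suc k) < norm z \<and> norm z < 1 \<and>
      \<delta> * (1 - (norm (?\<psi> z))\<^sup>2) < 1 - (norm z)\<^sup>2" for k
    by (auto simp: not_le dest: spec[of _ "1 - 1 / real (Suc k)"])
  then obtain z where z: "\<And>k. 1 - 1 / real (Suc k) < norm (z k)" "\<And>k. norm (z k) < 1"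
    and defect: "\<And>k. \<delta> * (1 - (norm (?\<psi> (z k)))\<^sup>2) < 1 - (norm (z k))\<^sup>2"
    by metis
  define s where "s k = sqrt (1 - (norm (z k))\<^sup>2)" for k
  have s0: "s k > 0" for k
    using z(2)[of k] by (simp add: s_def abs_square_less_1)
  have psi: "norm (?\<psi> (z k)) < 1" for k
    by (rule norm_scalar_rep_less[OF self_map z(2)])
  have "(\<lambda>k. norm (z k)) \<longlonglongrightarrow> 1"
  proof (rule tendsto_sandwich[of "\<lambda>k. 1 - 1 / real (Suc k)" _ _ "\<lambda>_. 1"])
    show "(\<lambda>k. 1 - 1 / real (Suc k)) \<longlonglongrightarrow> 1"
      using tendsto_diff[OF tendsto_const LIMSEQ_inverse_real_of_nat, of 1] by (simp add: inverse_eq_divide)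
  qed (use z in \<open>auto intro: always_eventually less_imp_le\<close>)
  then have "s \<longlonglongrightarrow> sqrt (1 - 1\<^sup>2)"
    unfolding s_def by (intro tendsto_intros)
  then have s_lim: "s \<longlonglongrightarrow> 0"
    by simp
  have "\<exists>f. f \<in> H2_ball \<and> H2_norm f \<le> 1 \<and>
      norm (f (scalar_tuple (?\<psi> (z k))) :: 'h \<Rightarrow>\<^sub>L 'h) \<ge> 1 / (2 * sqrt (1 - (norm (?\<psi> (z k)))\<^sup>2))" for k
    using exists_test_function[OF psi, of k] by blast
  then obtain f :: "nat \<Rightarrow> ('h \<Rightarrow>\<^sub>L 'h) ^ 'n \<Rightarrow> 'h \<Rightarrow>\<^sub>L 'h" where f: "\<And>k. f k \<in> H2_ball" "\<And>k. H2_norm (f k) \<le> 1"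
    and f_large: "\<And>k. norm (f k (scalar_tuple (?\<psi> (z k)))) \<ge> 1 / (2 * sqrt (1 - (norm (?\<psi> (z k)))\<^sup>2))"
    by metis
  define g where "g k = comp_op \<phi> (f k)" for k
  have g: "g k \<in> H2_ball" for k
    using compact f(1) by (auto simp: g_def H2_compact_operator_def)
  have in_ball: "(scalar_tuple (z k) :: ('h \<Rightarrow>\<^sub>L 'h) ^ 'n) \<in> nc_ball" for k
    by (rule scalar_tuple_in_nc_ball[OF z(2)])
  \<comment> \<open>The violated inequality gives a lower bound sqrt \<delta> / (2 s k), that is 4
    \<epsilon> / s k. The distance to the limit and the tail of the limit cost \<epsilon> / s k
    each, so 2 \<epsilon> / s k is left over.\<close>
  define \<epsilon> where "\<epsilon> = sqrt \<delta> / 8"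
  have \<epsilon>: "\<epsilon> > 0"
    using \<delta> by (simp add: \<epsilon>_def)
  have g_large: "norm (g k (scalar_tuple (z k))) \<ge> 4 * \<epsilon> / s k" for k
  proof -
    let ?t = "sqrt (1 - (norm (?\<psi> (z k)))\<^sup>2)"
    have t: "?t > 0"
      using psi[of k] by (simp add: abs_square_less_1)
    have "sqrt (\<delta> * (1 - (norm (?\<psi> (z k)))\<^sup>2)) \<le> s k"
      unfolding s_def using defect[of k] by (intro real_sqrt_le_mono) simp
    then have "8 * \<epsilon> * ?t \<le> s k"
      by (simp add: \<epsilon>_def real_sqrt_mult)
    then have "4 * \<epsilon> / s k \<le> 1 / (2 * ?t)"
      using s0[of k] t by (simp add: field_simps)
    also have "\<dots> \<le> norm (g k (scalar_tuple (z k)))"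
      using f_large[of k] in_ball[of k] by (simp add: g_def comp_op_def apply_scalar_tuple[OF self_map z(2)])
    finally show ?thesis .
  qed
  interpret H2: Metric_space "H2_ball :: (('h \<Rightarrow>\<^sub>L 'h) ^ 'n \<Rightarrow> 'h \<Rightarrow>\<^sub>L 'h) set" "\<lambda>f g. H2_norm (H2_diff f g)"
    by (rule Metric_space_H2)
  have top: "H2_topology = H2.mtopology"
    by (simp add: H2_topology_def)
  let ?T = "comp_op \<phi> ` {f \<in> H2_ball. H2_norm f \<le> 1}"
  have "?T \<subseteq> H2_ball"
    using compact by (auto simp: H2_compact_operator_def)
  then have "?T \<subseteq> H2.mtopology closure_of ?T"
    by (intro closure_of_subset) simp
  then have "range g \<subseteq> H2.mtopology closure_of ?T"
    using f by (auto simp: g_def)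
  moreover have "compactin H2.mtopology (H2.mtopology closure_of ?T)"
    using compact by (simp add: H2_compact_operator_def top)
  ultimately obtain l r where r: "strict_mono (r :: nat \<Rightarrow> nat)"
    and lim: "limitin H2.mtopology (g \<circ> r) l sequentially"
    unfolding H2.compactin_sequentially by blast
  then have l: "l \<in> H2_ball"
    by (simp add: H2.limitin_metric)
  let ?c = "\<lambda>\<alpha>. (cmod (free_coeff l \<alpha>))\<^sup>2"
  \<comment> \<open>F is chosen for the limit alone, so the constant C below does not depend on
    k.\<close>
  obtain F where F: "finite F" "dist (sum ?c F) (infsum ?c UNIV) \<le> \<epsilon>\<^sup>2"
    using infsum_finite_approximation[OF H2_ballD(3)[OF l], of "\<epsilon>\<^sup>2"] \<epsilon> by auto
  have "infsum ?c (UNIV - F) = infsum ?c UNIV - infsum ?c F"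
    by (intro infsum_Diff H2_ballD(3)[OF l]) (use F in auto)
  then have "infsum ?c (- F) \<le> \<epsilon>\<^sup>2"
    using F by (simp add: Compl_eq_Diff_UNIV dist_real_def)
  then have tail: "sqrt (infsum ?c (- F)) \<le> \<epsilon>"
    using \<epsilon> by (intro real_le_lsqrt) (auto intro: infsum_nonneg)
  define C where "C = (\<Sum>\<alpha>\<in>F. cmod (free_coeff l \<alpha>))"
  have "\<forall>\<^sub>F k in sequentially. H2_norm (H2_diff (g (r k)) l) < \<epsilon>"
    using lim \<epsilon> by (auto simp: H2.limitin_metric elim: eventually_mono)
  then have "\<forall>\<^sub>F k in sequentially. 2 * \<epsilon> \<le> C * s (r k)"
  proof eventually_elim
    case (elim k)
    let ?z = "scalar_tuple (z (r k)) :: ('h \<Rightarrow>\<^sub>L 'h) ^ 'n"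
    let ?d = "H2_diff (g (r k)) l"
    \<comment> \<open>With no coefficients split off, closeness in the Hardy norm becomes closeness
      at the point, up to the kernel norm 1 / s.\<close>
    have "norm (?d ?z) \<le> H2_norm ?d / s (r k)"
      using norm_H2_eval_le[OF H2_diff_in_H2[OF g l] z(2), of "{}" "r k"]
      by (simp add: H2_norm_def s_def)
    also have "\<dots> \<le> \<epsilon> / s (r k)"
      using elim s0[of "r k"] by (intro divide_right_mono) auto
    finally have 1: "norm (?d ?z) \<le> \<epsilon> / s (r k)" .
    have "norm (l ?z) \<le> C + sqrt (infsum ?c (- F)) / s (r k)"
      unfolding C_def s_def by (rule norm_H2_eval_le[OF l z(2) F(1)])
    also have "\<dots> \<le> C + \<epsilon> / s (r k)"
      using tail s0[of "r k"] by (intro add_left_mono divide_right_mono) auto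
    finally have 2: "norm (l ?z) \<le> C + \<epsilon> / s (r k)" .
    have "?d ?z = g (r k) ?z - l ?z"
      using in_ball by (simp add: H2_lincomb_def)
    then have "norm (g (r k) ?z) \<le> norm (?d ?z) + norm (l ?z)"
      by (metis diff_add_cancel norm_triangle_ineq)
    with 1 2 g_large[of "r k"] have "4 * \<epsilon> / s (r k) \<le> \<epsilon> / s (r k) + (C + \<epsilon> / s (r k))"
      by linarith
    then show ?case
      using s0[of "r k"] by (simp add: field_simps)
  qed
  moreover have "(\<lambda>k. C * s (r k)) \<longlonglongrightarrow> C * 0"
    by (intro tendsto_intros LIMSEQ_subseq_LIMSEQ[OF s_lim r, unfolded o_def])
  ultimately have "2 * \<epsilon> \<le> C * 0"
    by (intro tendsto_lowerbound) auto
  then show False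
    using \<epsilon> by simp
qed

end

section \<open>Fixed points\<close>

text \<open>Truncation is needed because \<psi> lives on an open ball and is not known in advance to
  preserve any closed ball inside it. The factor 1/2 is a convenient choice: any positive constant
  up to 1 gives |\<psi> z| \<le> |z| near the sphere, which is what the argument uses.\<close>

lemma exists_fixed_point_of_defect:
  fixes \<psi> :: "'a::euclidean_space \<Rightarrow> 'a"
  assumes cont: "continuous_on (ball 0 1) \<psi>"
    and ball: "\<And>z. norm z < 1 \<Longrightarrow> norm (\<psi> z) < 1"
    and r: "r < 1" "\<And>z. r < norm z \<Longrightarrow> norm z < 1 \<Longrightarrow> 1 - (norm z)\<^sup>2 \<le> (1 - (norm (\<psi> z))\<^sup>2) / 2"
  shows "\<exists>z. norm z < 1 \<and> \<psi> z = z"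
proof -
  \<comment> \<open>R lies above r so that the hypothesis applies on the sphere of radius R, and
    above 0 so that the truncation can divide by it.\<close>
  obtain R where R: "max r 0 < R" "R < 1"
    using dense[of "max r 0" 1] r(1) by auto
  \<comment> \<open>This is \<psi> followed by the radial retraction onto the closed ball of radius
    R; the form with \<open>max\<close> makes it visibly continuous.\<close>
  define F where "F z = (R / max R (norm (\<psi> z))) *\<^sub>R \<psi> z" for z
  have pos: "0 < max R (norm (\<psi> z))" for z
    using R by auto
  have "continuous_on (cball 0 R) \<psi>"
    by (rule continuous_on_subset[OF cont]) (use R in auto)
  then have "continuous_on (cball 0 R) F"
    unfolding F_def using pos by (intro continuous_intros) (auto simp: less_imp_neq[symmetric])
  moreover have "F \<in> cball 0 R \<rightarrow> cball 0 R"
  proof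
    fix z :: 'a
    have "norm (F z) = R * (norm (\<psi> z) / max R (norm (\<psi> z)))"
      using R pos[of z] by (simp add: F_def)
    also have "\<dots> \<le> R * 1"
      using R pos[of z] by (intro mult_left_mono) auto
    finally show "F z \<in> cball 0 R"
      by simp
  qed
  ultimately obtain z where z: "z \<in> cball 0 R" "F z = z"
    using brouwer_ball[of R 0 F] R by auto
  have z1: "norm z < 1"
    using z R by simp
  show ?thesis
  proof (cases "norm (\<psi> z) \<le> R")
    case True
    then show ?thesis
      using z(2) z1 R by (intro exI[of _ z]) (auto simp: F_def max_def split: if_splits)
  next
    case False
    then have "norm z = R"
      using R arg_cong[OF z(2), of norm] by (simp add: F_def max_def split: if_splits)
    then have "1 - R\<^sup>2 \<le> (1 - (norm (\<psi> z))\<^sup>2) / 2"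
      using r(2)[of z] R by simp
    moreover have "R\<^sup>2 < (norm (\<psi> z))\<^sup>2" "(norm (\<psi> z))\<^sup>2 < 1"
      using False R ball[OF z1] by (auto simp: abs_square_less_1 intro!: power_strict_mono)
    ultimately show ?thesis
      by argo
  qed
qed

section \<open>Hermitian geometry and complex slices of the ball\<close>

text \<open>The Hermitian product, complex linear in the first argument, so that projections built
  from it are holomorphic.\<close>

definition vec_cinner :: "complex ^ 'n \<Rightarrow> complex ^ 'n \<Rightarrow> complex" where
  "vec_cinner w u = (\<Sum>i\<in>UNIV. w $ i * cnj (u $ i))"

lemma vec_cinner_add_left: "vec_cinner (v + w) u = vec_cinner v u + vec_cinner w u"
  by (simp add: vec_cinner_def algebra_simps sum.distrib)

lemma vec_cinner_diff_left: "vec_cinner (v - w) u = vec_cinner v u - vec_cinner w u"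
  by (simp add: vec_cinner_def algebra_simps sum_subtractf)

lemma vec_cinner_scale_left: "vec_cinner (c *s w) u = c * vec_cinner w u"
  by (simp add: vec_cinner_def algebra_simps sum_distrib_left)

lemma vec_cinner_commute: "vec_cinner w u = cnj (vec_cinner u w)"
  by (simp add: vec_cinner_def mult.commute)

lemma vec_cinner_self: "vec_cinner w w = of_real ((norm w)\<^sup>2)"
  by (simp only: vec_cinner_def norm_power2_vec)

lemma cmod_vec_cinner_le: "cmod (vec_cinner w u) \<le> norm w * norm u"
  using norm_sum_mult_le_L2[of "\<lambda>i. w $ i" "\<lambda>i. cnj (u $ i)" UNIV]
  by (simp add: vec_cinner_def norm_vec_def)

lemma norm_sq_add_vec:
  "(norm (v + w))\<^sup>2 = (norm v)\<^sup>2 + 2 * Re (vec_cinner v w) + (norm w)\<^sup>2"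
proof -
  have "of_real ((norm (v + w))\<^sup>2) = vec_cinner v v + vec_cinner v w + (cnj (vec_cinner v w) + vec_cinner w w)"
    unfolding vec_cinner_self[symmetric]
    by (simp add: vec_cinner_def algebra_simps sum.distrib)
  then have "(norm (v + w))\<^sup>2 = Re (vec_cinner v v + vec_cinner v w + (cnj (vec_cinner v w) + vec_cinner w w))"
    by (metis Re_complex_of_real)
  then show ?thesis
    by (simp add: vec_cinner_self del: of_real_power)
qed

lemma norm_vector_scale: "norm (c *s (w :: complex ^ 'n)) = cmod c * norm w"
  by (simp add: norm_vec_def norm_mult L2_set_right_distrib)

text \<open>The holomorphic retraction of the ball onto its slice \<open>c + \<complex> u\<close> is
  \<open>w \<mapsto> c + \<rho>\<^sup>2 \<langle>w, u\<rangle> / (1 - \<langle>w, c\<rangle>) u\<close> with \<open>\<rho>\<^sup>2 = 1 - \<parallel>c\<parallel>\<^sup>2\<close>; the inequality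
  says that it maps into the slice, with a bound for the distance to the sphere.\<close>

lemma slice_retraction_defect:
  fixes w u c :: "complex ^ 'n"
  assumes u: "norm u = 1" and uc: "vec_cinner u c = 0" and c: "norm c < 1" and w: "norm w \<le> 1"
  shows "(1 - (norm c)\<^sup>2) * (1 - (norm w)\<^sup>2) + (1 - (norm c)\<^sup>2) * (cmod (vec_cinner w u))\<^sup>2
    \<le> (cmod (1 - vec_cinner w c))\<^sup>2"
proof -
  let ?q = "vec_cinner w u"
  \<comment> \<open>As c is orthogonal to u, only the component v of w orthogonal to u enters the
    product with c.\<close>
  define v where "v = w - ?q *s u"
  have w_eq: "w = v + ?q *s u"
    by (simp add: v_def)
  have vu: "vec_cinner v u = 0"
    by (simp add: v_def vec_cinner_diff_left vec_cinner_scale_left vec_cinner_self u)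
  have "vec_cinner v (?q *s u) = 0"
    by (subst vec_cinner_commute) (simp add: vec_cinner_scale_left vec_cinner_commute[of u v] vu)
  then have nw: "(norm w)\<^sup>2 = (norm v)\<^sup>2 + (cmod ?q)\<^sup>2"
    by (subst w_eq, subst norm_sq_add_vec) (simp add: norm_vector_scale u)
  have "(norm v)\<^sup>2 \<le> (norm w)\<^sup>2"
    by (simp add: nw)
  then have v1: "norm v \<le> 1"
    using w power2_le_imp_le[of "norm v" "norm w"] by simp
  have "vec_cinner w c = vec_cinner v c"
    by (subst w_eq) (simp add: vec_cinner_add_left vec_cinner_scale_left uc)
  then have "cmod (vec_cinner w c) \<le> norm v * norm c"
    using cmod_vec_cinner_le by metis
  then have "1 - norm v * norm c \<le> cmod (1 - vec_cinner w c)"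
    using norm_triangle_ineq2[of 1 "vec_cinner w c"] by simp
  moreover have "norm v * norm c \<le> 1"
    using v1 c by (simp add: mult_le_one)
  ultimately have "(1 - norm v * norm c)\<^sup>2 \<le> (cmod (1 - vec_cinner w c))\<^sup>2"
    by (intro power_mono) auto
  \<comment> \<open>The last square measures the slack of the estimate and is discarded at the
    end.\<close>
  moreover have "(1 - norm v * norm c)\<^sup>2 = (1 - (norm c)\<^sup>2) * (1 - (norm v)\<^sup>2) + (norm c - norm v)\<^sup>2"
    by (simp add: power2_eq_square algebra_simps)
  moreover have "(1 - (norm c)\<^sup>2) * (1 - (norm v)\<^sup>2) =
      (1 - (norm c)\<^sup>2) * (1 - (norm w)\<^sup>2) + (1 - (norm c)\<^sup>2) * (cmod ?q)\<^sup>2"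
    by (simp add: nw algebra_simps)
  ultimately show ?thesis
    by (smt (verit) zero_le_power2)
qed

text \<open>Conjugating by the Moebius map that takes \<alpha> to 0 turns \<beta> into a nonzero
  fixed point of a map fixing 0. This is the equality case of the Schwarz lemma: the conjugated map
  is a rotation, and having a nonzero fixed point it is the identity.\<close>

lemma disc_self_map_two_fixed_points:
  assumes h: "h holomorphic_on ball 0 1" "\<And>z. cmod z < 1 \<Longrightarrow> cmod (h z) < 1"
    and \<alpha>: "cmod \<alpha> < 1" "h \<alpha> = \<alpha>" and \<beta>: "cmod \<beta> < 1" "h \<beta> = \<beta>" and "\<alpha> \<noteq> \<beta>"
    and z: "cmod z < 1"
  shows "h z = z"
proof -
  define M where "M = Moebius_function 0 \<alpha>"
  define M' where "M' = Moebius_function 0 (- \<alpha>)"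
  have M: "M holomorphic_on ball 0 1" "\<And>x. cmod x < 1 \<Longrightarrow> cmod (M x) < 1"
    and M': "M' holomorphic_on ball 0 1" "\<And>x. cmod x < 1 \<Longrightarrow> cmod (M' x) < 1"
    using \<alpha>(1) by (auto simp: M_def M'_def Moebius_function_holomorphic Moebius_function_norm_lt_1)
  have MM': "M (M' x) = x" and M'M: "M' (M x) = x" if "cmod x < 1" for x
    using that \<alpha>(1) by (auto simp: M_def M'_def Moebius_function_compose)
  have M0: "M \<alpha> = 0" "M' 0 = \<alpha>"
    using M'M[OF \<alpha>(1)] by (auto simp: M_def Moebius_function_eq_zero)
  define k where "k = M \<circ> (h \<circ> M')"
  have k_holo: "k holomorphic_on ball 0 1"
    unfolding k_def
  proof (rule holomorphic_on_compose_gen[OF _ M(1)])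
    show "h \<circ> M' holomorphic_on ball 0 1"
      by (rule holomorphic_on_compose_gen[OF M'(1) h(1)]) (use M' in auto)
  qed (use h M' in auto)
  have k0: "k 0 = 0"
    by (simp add: k_def M0 \<alpha>)
  have k1: "cmod (k x) < 1" if "cmod x < 1" for x
    using that by (simp add: k_def M h(2) M')
  have "M \<beta> \<noteq> 0"
    using M'M[OF \<beta>(1)] M0 \<open>\<alpha> \<noteq> \<beta>\<close> by auto
  moreover have k\<beta>: "k (M \<beta>) = M \<beta>"
    by (simp add: k_def M'M \<beta>)
  ultimately have "\<exists>c. (\<forall>x. cmod x < 1 \<longrightarrow> k x = c * x) \<and> cmod c = 1"
    using M(2)[OF \<beta>(1)] by (intro Schwarz_Lemma(3)[OF k_holo k0 k1, of 0]) auto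
  then obtain c where c: "\<And>x. cmod x < 1 \<Longrightarrow> k x = c * x"
    by blast
  have "c = 1"
    using c[OF M(2)[OF \<beta>(1)]] k\<beta> \<open>M \<beta> \<noteq> 0\<close> by simp
  then have "k (M z) = M z"
    using c[OF M(2)[OF z]] by simp
  then have "M (h z) = M z"
    by (simp add: k_def M'M z)
  then show ?thesis
    using M'M[OF h(2)[OF z]] M'M[OF z] by simp
qed

text \<open>The line through the two fixed points cuts the ball in a disc, on which \<open>\<psi>\<close> followed by
  the retraction onto the slice is the identity by the Schwarz--Pick lemma.\<close>

lemma two_fixed_points_defect:
  fixes \<psi> :: "complex ^ 'n \<Rightarrow> complex ^ 'n"
  assumes holo: "holomorphic_map_on \<psi> (ball 0 1)"
    and ball: "\<And>z. norm z < 1 \<Longrightarrow> norm (\<psi> z) < 1"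
    and a: "norm a < 1" "\<psi> a = a" and b: "norm b < 1" "\<psi> b = b" and "a \<noteq> b"
  shows "\<exists>K>0. \<forall>r<1. \<exists>z. r < norm z \<and> norm z < 1 \<and> 1 - (norm (\<psi> z))\<^sup>2 \<le> K * (1 - (norm z)\<^sup>2)"
proof -
  define l where "l = complex_of_real (norm (b - a))"
  have l: "l \<noteq> 0"
    using \<open>a \<noteq> b\<close> by (simp add: l_def)
  define u where "u = inverse l *s (b - a)"
  have u: "norm u = 1"
    using \<open>a \<noteq> b\<close> unfolding u_def norm_vector_scale by (simp add: l_def norm_inverse)
  define t where "t = vec_cinner a u"
  \<comment> \<open>The point of the line nearest to 0, hence the centre of the disc cut out by the
    ball; orthogonality to u makes squared norms add.\<close>
  define c where "c = a - t *s u"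
  have cu: "vec_cinner c u = 0"
    by (simp add: c_def vec_cinner_diff_left vec_cinner_scale_left vec_cinner_self u t_def)
  then have uc: "vec_cinner u c = 0"
    by (metis complex_cnj_zero vec_cinner_commute)
  have norm_slice: "(norm (c + x *s u))\<^sup>2 = (norm c)\<^sup>2 + (cmod x)\<^sup>2" for x
  proof -
    have "vec_cinner c (x *s u) = 0"
      by (metis complex_cnj_zero mult_zero_right uc vec_cinner_commute vec_cinner_scale_left)
    then show ?thesis
      by (simp add: norm_sq_add_vec norm_vector_scale u)
  qed
  have a_eq: "a = c + t *s u"
    by (simp add: c_def)
  have b_eq: "b = c + (t + l) *s u"
    using l by (simp add: c_def u_def vec_eq_iff field_simps)
  have "(norm c)\<^sup>2 \<le> (norm a)\<^sup>2"
    by (subst a_eq) (simp add: norm_slice)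
  also have "\<dots> < 1"
    using a by (simp add: abs_square_less_1)
  finally have c2: "(norm c)\<^sup>2 < 1" .
  then have c1: "norm c < 1"
    by (simp add: abs_square_less_1)
  define \<rho> where "\<rho> = sqrt (1 - (norm c)\<^sup>2)"
  have \<rho>: "\<rho> > 0" and \<rho>2: "\<rho>\<^sup>2 = 1 - (norm c)\<^sup>2"
    using c2 by (auto simp: \<rho>_def)
  \<comment> \<open>An affine parametrisation of the slice by the unit disc, \<rho> being the radius
    of the slice.\<close>
  define L where "L x = c + (\<rho> * x) *s u" for x :: complex
  have defect_L: "1 - (norm (L x))\<^sup>2 = \<rho>\<^sup>2 * (1 - (cmod x)\<^sup>2)" for x
    by (simp add: L_def norm_slice norm_mult power_mult_distrib \<rho>2 algebra_simps)
  have norm_L: "norm (L x) < 1 \<longleftrightarrow> cmod x < 1" for x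
  proof -
    have "norm (L x) < 1 \<longleftrightarrow> 0 < 1 - (norm (L x))\<^sup>2"
      by (simp add: abs_square_less_1)
    also have "\<dots> \<longleftrightarrow> cmod x < 1"
      unfolding defect_L using \<rho> by (simp add: zero_less_mult_iff abs_square_less_1)
    finally show ?thesis .
  qed
  \<comment> \<open>The retraction in the disc coordinate: L (H w) is the retraction of w onto the
    slice.\<close>
  define H where "H w = \<rho> * vec_cinner w u / (1 - vec_cinner w c)" for w
  have H_L: "H (L x) = x" for x
  proof -
    have "vec_cinner (L x) u = \<rho> * x"
      by (simp add: L_def vec_cinner_add_left vec_cinner_scale_left vec_cinner_self u cu)
    moreover have "1 - vec_cinner (L x) c = of_real (\<rho>\<^sup>2)"
      unfolding \<rho>2 by (simp add: L_def vec_cinner_add_left vec_cinner_scale_left vec_cinner_self uc)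
    ultimately show ?thesis
      using \<rho> by (simp add: H_def power2_eq_square)
  qed
  have one_minus: "1 - vec_cinner w c \<noteq> 0" if "norm w < 1" for w
  proof -
    have "cmod (vec_cinner w c) \<le> norm w * norm c"
      by (rule cmod_vec_cinner_le)
    also have "\<dots> < 1"
      using mult_strict_mono[OF that c1] by simp
    finally show ?thesis
      by auto
  qed
  have H_sq: "\<rho>\<^sup>2 * (1 - (norm w)\<^sup>2) \<le> (1 - (cmod (H w))\<^sup>2) * (cmod (1 - vec_cinner w c))\<^sup>2"
    if "norm w < 1" for w
  proof -
    have "(cmod (H w))\<^sup>2 * (cmod (1 - vec_cinner w c))\<^sup>2 = \<rho>\<^sup>2 * (cmod (vec_cinner w u))\<^sup>2"
      using one_minus[OF that] by (simp add: H_def norm_divide norm_mult power_divide power_mult_distrib)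
    then show ?thesis
      using slice_retraction_defect[OF u uc c1, of w] that by (simp add: \<rho>2 algebra_simps)
  qed
  have H_less: "cmod (H w) < 1" if "norm w < 1" for w
  proof -
    have "0 < \<rho>\<^sup>2 * (1 - (norm w)\<^sup>2)"
      using \<rho> that by (simp add: abs_square_less_1)
    then have "0 < (1 - (cmod (H w))\<^sup>2) * (cmod (1 - vec_cinner w c))\<^sup>2"
      using H_sq[OF that] by linarith
    then show ?thesis
      by (auto simp: zero_less_mult_iff abs_square_less_1)
  qed
  have comp_holo: "(\<lambda>x. \<psi> (L x) $ i) holomorphic_on ball 0 1" for i
  proof (rule holomorphic_onI)
    fix x :: complex assume "x \<in> ball 0 1"
    then have "L x \<in> ball 0 1"
      by (simp add: norm_L)
    then obtain D where D: "(\<psi> has_derivative D) (at (L x))" "\<And>c v. D (c *s v) = c *s D v"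
      using holo unfolding holomorphic_map_on_def by blast
    have "((\<lambda>x. L x $ j) has_derivative (\<lambda>v. (\<rho> * v) * u $ j)) (at x)" for j
      unfolding L_def by (auto intro!: derivative_eq_intros)
    then have "(L has_derivative (\<lambda>v. \<chi> j. (\<rho> * v) * u $ j)) (at x)"
      by (rule has_derivative_vecI)
    from diff_chain_at[OF this D(1)]
    have "((\<lambda>x. \<psi> (L x)) has_derivative (\<lambda>v. D ((\<rho> * v) *s u))) (at x)"
      by (simp add: o_def vector_scalar_mult_def)
    from bounded_linear.has_derivative[OF bounded_linear_vec_nth this, of i]
    have "((\<lambda>x. \<psi> (L x) $ i) has_derivative (\<lambda>v. \<rho> * D u $ i * v)) (at x)"
      by (simp add: D(2) mult_ac)
    then show "(\<lambda>x. \<psi> (L x) $ i) field_differentiable at x within ball 0 1"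
      using field_differentiable_at_within field_differentiable_def has_field_derivative_def by blast
  qed
  \<comment> \<open>On the disc this is \<psi> restricted to the slice and then retracted; it fixes
    the coordinates of both a and b.\<close>
  define h where "h x = H (\<psi> (L x))" for x
  have h_holo: "h holomorphic_on ball 0 1"
  proof -
    have cip: "(\<lambda>x. vec_cinner (\<psi> (L x)) v) holomorphic_on ball 0 1" for v
      unfolding vec_cinner_def by (intro holomorphic_intros comp_holo)
    show ?thesis
      unfolding h_def H_def
      by (intro holomorphic_intros cip) (use one_minus ball norm_L in auto)
  qed
  have h_less: "cmod (h x) < 1" if "cmod x < 1" for x
    using that by (simp add: h_def H_less ball norm_L)
  have a_L: "a = L (t / \<rho>)" and b_L: "b = L ((t + l) / \<rho>)"
    using \<rho> a_eq b_eq by (simp_all add: L_def)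
  have fixed: "h x = x" if "cmod x < 1" for x
  proof (rule disc_self_map_two_fixed_points[OF h_holo h_less])
    show "cmod (t / \<rho>) < 1" "cmod ((t + l) / \<rho>) < 1"
      using a(1) b(1) norm_L a_L b_L by metis+
    show "h (t / \<rho>) = t / \<rho>" "h ((t + l) / \<rho>) = (t + l) / \<rho>"
      using a(2) b(2) H_L a_L b_L unfolding h_def by metis+
    show "t / \<rho> \<noteq> (t + l) / \<rho>"
      using l \<rho> by simp
  qed (use that in auto)
  \<comment> \<open>The 4 is the square of the bound 2 for |1 - <w, c>|. One factor \<rho>^2 comes
    from the retraction inequality, the other from rescaling the disc to the slice.\<close>
  have slice_defect: "1 - (norm (\<psi> (L x)))\<^sup>2 \<le> 4 / \<rho> ^ 4 * (1 - (norm (L x))\<^sup>2)" if x: "cmod x < 1" for x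
  proof -
    let ?w = "\<psi> (L x)"
    have w: "norm ?w < 1"
      using x by (simp add: ball norm_L)
    have "cmod (vec_cinner ?w c) \<le> norm ?w * norm c"
      by (rule cmod_vec_cinner_le)
    also have "\<dots> \<le> 1"
      using w c1 by (simp add: mult_le_one)
    finally have "cmod (1 - vec_cinner ?w c) \<le> 2"
      using norm_triangle_ineq4[of 1 "vec_cinner ?w c"] by simp
    then have "(cmod (1 - vec_cinner ?w c))\<^sup>2 \<le> 2\<^sup>2"
      by (intro power_mono) auto
    moreover have "0 \<le> 1 - (cmod x)\<^sup>2"
      using x by (simp add: abs_square_le_1)
    ultimately have "(1 - (cmod x)\<^sup>2) * (cmod (1 - vec_cinner ?w c))\<^sup>2 \<le> (1 - (cmod x)\<^sup>2) * 4"
      by (intro mult_left_mono) auto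
    then have "\<rho>\<^sup>2 * (1 - (norm ?w)\<^sup>2) \<le> (1 - (cmod x)\<^sup>2) * 4"
      using H_sq[OF w] fixed[OF x] by (simp add: h_def)
    then have "1 - (norm ?w)\<^sup>2 \<le> (1 - (cmod x)\<^sup>2) * 4 / \<rho>\<^sup>2"
      using \<rho> by (simp add: pos_le_divide_eq mult.commute)
    also have "\<dots> = 4 / \<rho> ^ 4 * (1 - (norm (L x))\<^sup>2)"
      unfolding defect_L using \<rho> by (simp add: power4_eq_xxxx power2_eq_square)
    finally show ?thesis .
  qed
  show ?thesis
  proof (intro exI[of _ "4 / \<rho> ^ 4"] conjI allI impI)
    fix r :: real assume "r < 1"
    \<comment> \<open>For real x in [0, 1) one has |L x| \<ge> x because \<rho> \<le> 1, so the
      slice contains points arbitrarily close to the sphere.\<close>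
    then obtain x where x: "max r 0 < x" "x < 1"
      using dense[of "max r 0" 1] by auto
    have "\<rho>\<^sup>2 * (1 - x\<^sup>2) \<le> 1 * (1 - x\<^sup>2)"
      using x by (intro mult_right_mono) (auto simp: \<rho>2 abs_square_le_1)
    then have "x\<^sup>2 \<le> (norm (L x))\<^sup>2"
      using defect_L[of x] by simp
    then have "x \<le> norm (L x)"
      by (rule power2_le_imp_le) simp
    then show "\<exists>z. r < norm z \<and> norm z < 1 \<and> 1 - (norm (\<psi> z))\<^sup>2 \<le> 4 / \<rho> ^ 4 * (1 - (norm z)\<^sup>2)"
      using x slice_defect[of x] by (intro exI[of _ "L x"]) (auto simp: norm_L)
  qed (use \<rho> in simp)
qed

theorem theorem5p7:
  fixes \<phi> :: "('h::complex_hilbert \<Rightarrow>\<^sub>L 'h) ^ 'n \<Rightarrow> ('h \<Rightarrow>\<^sub>L 'h) ^ 'n"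
  assumes "separable_space (euclidean :: 'h topology)"
    and "\<not> (\<exists>B :: 'h set. finite B \<and> module.span (*\<^sub>C) B = UNIV)"
    and "free_holomorphic_self_map \<phi>"
    and "H2_compact_operator (comp_op \<phi>)"
  shows "holomorphic_map_on (scalar_rep \<phi>) (ball 0 1) \<and>
    scalar_rep \<phi> ` ball 0 1 \<subseteq> ball 0 1 \<and>
    (\<exists>!z. z \<in> ball 0 1 \<and> scalar_rep \<phi> z = z)"
proof -
  interpret infinite_dimensional "TYPE('h)"
    by unfold_locales (rule assms(2))
  let ?\<psi> = "scalar_rep \<phi>"
  have holo: "holomorphic_map_on ?\<psi> (ball 0 1)"
    by (rule holomorphic_scalar_rep[OF assms(3)])
  have ball: "norm (?\<psi> z) < 1" if "norm z < 1" for z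
    by (rule norm_scalar_rep_less[OF assms(3) that])
  have defect: "\<exists>r<1. \<forall>z. r < norm z \<longrightarrow> norm z < 1 \<longrightarrow>
      1 - (norm z)\<^sup>2 \<le> \<delta> * (1 - (norm (?\<psi> z))\<^sup>2)" if "0 < \<delta>" for \<delta>
    by (rule compact_comp_op_defect[OF assms(3,4) that])
  have "continuous_on (ball 0 1) ?\<psi>"
    using holo unfolding holomorphic_map_on_def
    by (meson continuous_at_imp_continuous_on has_derivative_continuous)
  moreover obtain r where "r < 1" "\<And>z. r < norm z \<Longrightarrow> norm z < 1 \<Longrightarrow>
      1 - (norm z)\<^sup>2 \<le> (1 - (norm (?\<psi> z))\<^sup>2) / 2"
    using defect[of "1 / 2"] by auto
  ultimately have "\<exists>z. norm z < 1 \<and> ?\<psi> z = z"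
    using ball by (intro exists_fixed_point_of_defect)
  moreover have "a = b" if a: "norm a < 1" "?\<psi> a = a" and b: "norm b < 1" "?\<psi> b = b" for a b
  proof (rule ccontr)
    assume "a \<noteq> b"
    then obtain K where K: "K > 0" and "\<And>r. r < 1 \<Longrightarrow>
        \<exists>z. r < norm z \<and> norm z < 1 \<and> 1 - (norm (?\<psi> z))\<^sup>2 \<le> K * (1 - (norm z)\<^sup>2)"
      using two_fixed_points_defect[OF holo ball a b] by blast
    \<comment> \<open>With this constant the two opposite bounds combine to d \<le> d / 2 for d = 1
      - |z|^2 > 0.\<close>
    moreover obtain r where "r < 1" and r: "\<And>z. r < norm z \<Longrightarrow> norm z < 1 \<Longrightarrow>
        1 - (norm z)\<^sup>2 \<le> 1 / (2 * K) * (1 - (norm (?\<psi> z))\<^sup>2)"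
      using defect[of "1 / (2 * K)"] K by auto
    ultimately obtain z where z: "r < norm z" "norm z < 1"
      and le: "1 - (norm (?\<psi> z))\<^sup>2 \<le> K * (1 - (norm z)\<^sup>2)"
      by blast
    have "1 - (norm z)\<^sup>2 \<le> 1 / (2 * K) * (K * (1 - (norm z)\<^sup>2))"
      by (rule order_trans[OF r[OF z] mult_left_mono[OF le]]) (use K in simp)
    also have "\<dots> = (1 - (norm z)\<^sup>2) / 2"
      using K by simp
    moreover have "(norm z)\<^sup>2 < 1"
      using z(2) by (simp add: abs_square_less_1)
    ultimately show False
      by simp
  qed
  ultimately show ?thesis
    using holo ball by auto
qed

end
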